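(* Let $d\ge 1$, $\lambda>0$, and let $a:\mathbb{R}\to\mathbb{R}^d$ be the kinetic velocity. Let $u_0\in L^1(\mathbb{R}^d)$, let $u(t,x)$ be real valued, and assume that $M(t,x,\xi)=\chi(\xi,u(t,x))$ belongs to $C([0,T],V_1)$ for every $T>0$ and satisfies the free transport equation $$\partial_t M+a(\xi)\cdot\nabla_x M=0,\qquad M(0,x,\xi)=\chi(\xi,u_0(x)).$$ Let $f\in C([0,\infty);V_1)$ be the distributional solution of $$\partial_t f+a(\xi)\cdot\nabla_x f=\lambda\,(M-f),\qquad f(0,x,\xi)=f_0(x,\xi),$$ with $f_0\in V_1$. Then $$\|f(t)-M(t)\|_{V_1}\longrightarrow 0\quad\text{as } t\to+\infty,$$ and the decay is exponential in time with rate $\lambda$ (that is, the norm is $O(e^{-\lambda t})$). Moreover, with $\widehat u(t,x)=\int_{\mathbb{R}}f(t,x,\xi)\,d\xi$, $$\|\widehat u(t)-u(t)\|_{L^1(\mathbb{R}^d)}\longrightarrow 0\quad\text{as } t\to+\infty,$$ with the same exponential decay.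
   Context: $V_1=L^1(\mathbb{R}^d_x\times\mathbb{R}_\xi)$. For $\xi,u\in\mathbb{R}$, $\chi(\xi,u)=+1$ if $0<\xi<u$, $-1$ if $u<\xi<0$, and $0$ otherwise; hence $\int_{\mathbb{R}}\chi(\xi,u)\,d\xi=u$. The function $a=(A_1',\dots,A_d')\in L^\infty_{loc}(\mathbb{R};\mathbb{R}^d)$ comes from the scalar conservation law $\partial_t u+\sum_i\partial_{x_i}A_i(u)=0$. All equations are understood in the sense of distributions. *)

theory Defs
  imports "HOL-Analysis.Analysis" "HOL-Library.Landau_Symbols"
begin

definition chi :: "real \<Rightarrow> real \<Rightarrow> real" where
  "chi \<xi> u = (if 0 < \<xi> \<and> \<xi> < u then 1 else if u < \<xi> \<and> \<xi> < 0 then -1 else 0)"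

(* Elements of L^1 are represented by Borel functions that are integrable for lborel;
   equality in L^1 is equality almost everywhere. *)
definition L1_norm :: "('a::euclidean_space \<Rightarrow> real) \<Rightarrow> real" where
  "L1_norm g = (LINT z|lborel. \<bar>g z\<bar>)"

(* The space C(I; L^1): continuity in time is with respect to the L^1 norm. *)
definition cont_L1 :: "real set \<Rightarrow> (real \<Rightarrow> 'a::euclidean_space \<Rightarrow> real) \<Rightarrow> bool" where
  "cont_L1 I g \<longleftrightarrow>
     (\<forall>t\<in>I. integrable lborel (g t)) \<and>
     (\<forall>t\<in>I. ((\<lambda>s. L1_norm (\<lambda>z. g s z - g t z)) \<longlongrightarrow> 0) (at t within I))"

definition Linf_loc :: "(real \<Rightarrow> 'b::euclidean_space) \<Rightarrow> bool" where
  "Linf_loc a \<longleftrightarrow> a \<in> borel_measurable borel \<and>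
     (\<forall>K. compact K \<longrightarrow> (\<exists>C. AE \<xi> in lborel. \<xi> \<in> K \<longrightarrow> norm (a \<xi>) \<le> C))"

primrec C_k :: "nat \<Rightarrow> ('a::euclidean_space \<Rightarrow> real) \<Rightarrow> bool" where
  "C_k 0 \<phi> \<longleftrightarrow> continuous_on UNIV \<phi>"
| "C_k (Suc k) \<phi> \<longleftrightarrow> (\<forall>z. \<phi> differentiable (at z)) \<and>
     (\<forall>v. C_k k (\<lambda>z. frechet_derivative \<phi> (at z) v))"

(* C_c^infinity(\<Omega>), its elements being extended by zero to the whole space. *)
definition test_function :: "'a::euclidean_space set \<Rightarrow> ('a \<Rightarrow> real) \<Rightarrow> bool" where
  "test_function \<Omega> \<phi> \<longleftrightarrow> (\<forall>k. C_k k \<phi>) \<and>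
     compact (closure {z. \<phi> z \<noteq> 0}) \<and> closure {z. \<phi> z \<noteq> 0} \<subseteq> \<Omega>"

definition d_t :: "(real \<times> (real ^ 'n::finite) \<times> real \<Rightarrow> real) \<Rightarrow>
    real \<times> (real ^ 'n) \<times> real \<Rightarrow> real" where
  "d_t \<phi> z = frechet_derivative \<phi> (at z) (1, 0, 0)"

definition d_x :: "'n::finite \<Rightarrow> (real \<times> (real ^ 'n) \<times> real \<Rightarrow> real) \<Rightarrow>
    real \<times> (real ^ 'n) \<times> real \<Rightarrow> real" where
  "d_x i \<phi> z = frechet_derivative \<phi> (at z) (0, axis i 1, 0)"

(* The equation d/dt g + a(\<xi>) . grad_x g = S in the sense of distributions on
   (0,\<infinity>) x R^d x R.  Here g and S are curves t \<mapsto> g t, t \<mapsto> S t with values in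
   L^1(R^d x R), so the pairing is integrated first over (x,\<xi>) and then over t; for curves
   in C([0,\<infinity>); L^1) no joint measurability of the chosen representatives is needed. *)
definition kinetic_eq ::
  "(real \<Rightarrow> real ^ 'n::finite) \<Rightarrow> (real \<Rightarrow> (real ^ 'n) \<times> real \<Rightarrow> real) \<Rightarrow>
   (real \<Rightarrow> (real ^ 'n) \<times> real \<Rightarrow> real) \<Rightarrow> bool" where
  "kinetic_eq a g S \<longleftrightarrow> (\<forall>\<phi>. test_function ({0<..} \<times> UNIV) \<phi> \<longrightarrow>
     - (LINT t:{0<..}|lborel. LINT (x, \<xi>)|lborel.
          g t (x, \<xi>) * (d_t \<phi> (t, x, \<xi>) + (\<Sum>i\<in>UNIV. a \<xi> $ i * d_x i \<phi> (t, x, \<xi>))))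
     = (LINT t:{0<..}|lborel. LINT (x, \<xi>)|lborel. S t (x, \<xi>) * \<phi> (t, x, \<xi>)))"

end

theory Submission
  imports Defs
begin

text \<open>
  The difference \<open>g = f - M\<close> satisfies \<open>\<partial>\<^sub>t g + a(\<xi>) \<cdot> \<nabla>g = - \<lambda> g\<close>, so \<open>e\<^bsup>\<lambda>t\<^esup> g\<close> is freely
  transported and its \<open>L\<^sup>1\<close> norm cannot grow.  As \<open>a\<close> is merely measurable, test functions cannot
  be moved along the characteristics directly.  They are moved along \<open>x + t p\<^sub>n(\<xi>)\<close> with polynomials
  \<open>p\<^sub>n \<rightarrow> a\<close> almost everywhere, bounded on the support; the error terms, proportional to \<open>a - p\<^sub>n\<close>,
  vanish by dominated convergence.  Hence \<open>e\<^bsup>\<lambda>t\<^esup> \<integral> g(t,x,\<xi>) R(x - t a(\<xi>), \<xi>)\<close> does not depend on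
  \<open>t\<close> for smooth \<open>R\<close>, then for indicators of boxes and of Borel sets; the images of
  \<open>{g(t) > 0}\<close> and \<open>{g(t) < 0}\<close> under the flow give the norm estimate.  The bound for \<open>u\<close> follows by
  integrating over \<open>\<xi>\<close>.
\<close>

subsection \<open>Smooth functions\<close>

text \<open>Polynomial velocities are affordable because the equation differentiates in t and x
  only. The derivative of p_n in \<xi>, which is not controlled as n grows, never enters; the error
  is the derivative of R in the direction (a - p_n, 0), so almost everywhere convergence with a
  local bound is enough. The source is absorbed by the weight e^(lam t) inside the test function,
  whose time derivative produces the matching term. The equations for f and M are tested separately
  and subtracted afterwards. Since an integral that does not exist has the default value 0, this
  requires integrability in time, which comes from continuity in L1. Testing yields only a vanishing
  distributional derivative on t > 0; constancy there and the passage to t = 0 are two further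
  steps, and both rest on the same continuity. In the norm estimate no change of variables is made:
  the flow keeps \<xi>, so its inverse is explicit and Borel, and sets can be carried along by
  it.\<close>

lemma C_k_SucI:
  assumes "\<And>z. (\<phi> has_derivative D z) (at z)" "\<And>v. C_k k (\<lambda>z. D z v)"
  shows "C_k (Suc k) \<phi>"
proof -
  have "frechet_derivative \<phi> (at z) = D z" for z
    using frechet_derivative_at[OF assms(1)] by simp
  with assms show ?thesis by (auto simp: differentiable_def)
qed

lemma C_k_Suc_has_derivative:
  "C_k (Suc k) f \<Longrightarrow> (f has_derivative frechet_derivative f (at z)) (at z)"
  by (simp add: frechet_derivative_works)

lemma C_k_SucD: "C_k (Suc k) f \<Longrightarrow> C_k k f"
proof (induction k arbitrary: f)
  case 0
  then show ?case
    by (auto simp: continuous_on_eq_continuous_at intro: differentiable_imp_continuous_within)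
next
  case (Suc k)
  have "C_k k (\<lambda>z. frechet_derivative f (at z) v)" for v
    by (rule Suc.IH) (use Suc.prems in simp)
  moreover have "\<forall>z. f differentiable (at z)" using Suc.prems by simp
  ultimately show ?case by (simp only: C_k.simps(2)) blast
qed

lemma C_k_imp_continuous: "C_k k f \<Longrightarrow> continuous_on UNIV f"
  by (induction k) (auto simp: continuous_on_eq_continuous_at intro: differentiable_imp_continuous_within)

lemma C_k_const: "C_k k (\<lambda>z. c)"
proof (induction k arbitrary: c)
  case (Suc k)
  show ?case by (rule C_k_SucI[where D="\<lambda>z v. 0"]) (auto intro: Suc)
qed auto

lemma C_k_linear: "bounded_linear L \<Longrightarrow> C_k k L"
proof (cases k)
  case (Suc m)
  assume "bounded_linear L"
  then show ?thesis unfolding Suc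
    by (intro C_k_SucI[where D="\<lambda>z. L"]) (auto intro: C_k_const bounded_linear_imp_has_derivative)
qed (auto intro: linear_continuous_on)

lemma C_k_add: "C_k k f \<Longrightarrow> C_k k g \<Longrightarrow> C_k k (\<lambda>z. f z + g z)"
proof (induction k arbitrary: f g)
  case (Suc k)
  show ?case
    by (rule C_k_SucI, rule has_derivative_add[OF Suc.prems[THEN C_k_Suc_has_derivative]])
      (use Suc in auto)
qed (auto intro!: continuous_intros)

lemma C_k_mult: "C_k k f \<Longrightarrow> C_k k g \<Longrightarrow> C_k k (\<lambda>z. f z * g z)"
proof (induction k arbitrary: f g)
  case (Suc k)
  have *: "C_k k f" "C_k k g" by (rule C_k_SucD, fact)+
  have **: "C_k k (\<lambda>z. frechet_derivative f (at z) v)" "C_k k (\<lambda>z. frechet_derivative g (at z) v)" for v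
    using Suc.prems by simp_all
  show ?case
    by (rule C_k_SucI, rule has_derivative_mult[OF Suc.prems[THEN C_k_Suc_has_derivative]])
      (intro C_k_add Suc.IH * **)
qed (auto intro!: continuous_intros)

lemma C_k_prod: "finite A \<Longrightarrow> (\<And>i. i \<in> A \<Longrightarrow> C_k k (f i)) \<Longrightarrow> C_k k (\<lambda>z. \<Prod>i\<in>A. f i z)"
  by (induction rule: finite_induct) (simp_all add: C_k_const C_k_mult)

lemma C_k_diff: "C_k k f \<Longrightarrow> C_k k g \<Longrightarrow> C_k k (\<lambda>z. f z - g z)"
  using C_k_add[of k f "\<lambda>z. (-1) * g z"] C_k_mult[OF C_k_const, of k g "-1"] by simp

lemma C_k_sum: "finite A \<Longrightarrow> (\<And>i. i \<in> A \<Longrightarrow> C_k k (f i)) \<Longrightarrow> C_k k (\<lambda>z. \<Sum>i\<in>A. f i z)"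
  by (induction rule: finite_induct) (simp_all add: C_k_const C_k_add)

text \<open>The induction on \<open>k\<close> runs over arbitrary \<open>R\<close> of all orders:
  the chain rule leads back to the same claim for the partial derivatives of \<open>R\<close>,
  composed with the same \<open>Y\<close>.\<close>

lemma C_k_compose:
  fixes R :: "'b::euclidean_space \<Rightarrow> real"
  assumes "\<And>m. C_k m R" "\<And>j. j \<in> Basis \<Longrightarrow> C_k k (\<lambda>z. Y z \<bullet> j)"
  shows "C_k k (\<lambda>z. R (Y z))"
  using assms
proof (induction k arbitrary: R)
  case 0
  have "continuous_on UNIV Y"
    using 0(2) by (subst continuous_on_componentwise) simp
  then have "continuous_on UNIV (\<lambda>z. R (Y z))"
    by (rule continuous_on_compose2[OF C_k_imp_continuous[OF 0(1)]]) simp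
  then show ?case by simp
next
  case (Suc k)
  define DY where "DY z v = (\<Sum>j\<in>Basis. frechet_derivative (\<lambda>z. Y z \<bullet> j) (at z) v *\<^sub>R j)" for z v
  have DY_comp: "(\<lambda>v. DY z v \<bullet> j) = frechet_derivative (\<lambda>z. Y z \<bullet> j) (at z)" if "j \<in> Basis" for z j
    unfolding DY_def using that by (simp add: inner_sum_left_Basis)
  have DY: "(Y has_derivative DY z) (at z)" for z
    by (subst has_derivative_componentwise_within)
      (use C_k_Suc_has_derivative[OF Suc.prems(2)] in \<open>simp add: DY_comp\<close>)
  have DR: "(R has_derivative frechet_derivative R (at y)) (at y)" for y
    by (rule C_k_Suc_has_derivative[OF Suc.prems(1)])
  \<comment> \<open>\<open>C_k\<close> speaks of derivatives in a fixed direction, while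
    \<open>DY z v\<close> moves with \<open>z\<close>. Expanding over \<open>Basis\<close> leaves
    fixed directions multiplied by scalar factors of class C^k.\<close>
  have expand: "frechet_derivative R (at (Y z)) (DY z v) =
      (\<Sum>j\<in>Basis. frechet_derivative (\<lambda>z. Y z \<bullet> j) (at z) v * frechet_derivative R (at (Y z)) j)" for z v
  proof -
    interpret linear "frechet_derivative R (at (Y z))"
      by (rule has_derivative_linear[OF DR])
    show ?thesis unfolding DY_def sum scale by (simp only: real_scaleR_def)
  qed
  show ?case
  proof (rule C_k_SucI)
    fix z show "((\<lambda>z. R (Y z)) has_derivative (\<lambda>v. frechet_derivative R (at (Y z)) (DY z v))) (at z)"
      by (rule has_derivative_compose[OF DY DR])
  next
    fix v
    have "C_k k (\<lambda>z. frechet_derivative R (at (Y z)) j)" for j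
    proof (rule Suc.IH)
      show "C_k m (\<lambda>y. frechet_derivative R (at y) j)" for m
        using Suc.prems(1)[of "Suc m"] by simp
    qed (rule C_k_SucD[OF Suc.prems(2)])
    moreover have "C_k k (\<lambda>z. frechet_derivative (\<lambda>z. Y z \<bullet> j) (at z) v)" if "j \<in> Basis" for j
      using Suc.prems(2)[OF that] by simp
    ultimately show "C_k k (\<lambda>z. frechet_derivative R (at (Y z)) (DY z v))"
      unfolding expand by (intro C_k_sum C_k_mult finite_Basis)
  qed
qed

lemma C_k_compose_linear:
  fixes L :: "'a::euclidean_space \<Rightarrow> 'b::euclidean_space"
  assumes "\<And>m. C_k m R" "bounded_linear L"
  shows "C_k k (\<lambda>z. R (L z))"
  by (rule C_k_compose[OF assms(1)])
    (intro C_k_linear bounded_linear_compose[OF bounded_linear_inner_left assms(2)])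

lemma C_k_compose_real:
  fixes F :: "real \<Rightarrow> real"
  assumes "\<And>m. C_k m F" "C_k k u"
  shows "C_k k (\<lambda>z. F (u z))"
  by (rule C_k_compose[OF assms(1)]) (use assms(2) in simp)

lemma C_k_inverse:
  "C_k k u \<Longrightarrow> (\<And>z. u z \<noteq> 0) \<Longrightarrow> C_k k (\<lambda>z. inverse (u z))"
proof (induction k)
  case (Suc k)
  have IH: "C_k k (\<lambda>z. inverse (u z))" by (rule Suc.IH[OF C_k_SucD[OF Suc.prems(1)] Suc.prems(2)])
  show ?case
  proof (rule C_k_SucI)
    fix z show "((\<lambda>z. inverse (u z)) has_derivative
        (\<lambda>v. (-1) * (inverse (u z) * frechet_derivative u (at z) v * inverse (u z)))) (at z)"
      using Deriv.has_derivative_inverse[OF Suc.prems(2)[of z] C_k_Suc_has_derivative[OF Suc.prems(1)]] by simp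
  next
    fix v
    show "C_k k (\<lambda>z. (-1) * (inverse (u z) * frechet_derivative u (at z) v * inverse (u z)))"
      by (intro C_k_mult C_k_const IH) (use Suc.prems(1) in auto)
  qed
qed (auto intro!: continuous_intros)

lemma C_k_polynomial: "real_polynomial_function p \<Longrightarrow> C_k k p"
  by (induction rule: real_polynomial_function.induct)
    (simp_all only: C_k_linear C_k_const C_k_add C_k_mult)

lemma C_k_exp: "C_k k (exp :: real \<Rightarrow> real)"
proof (induction k)
  case (Suc k)
  show ?case
    by (rule C_k_SucI[OF DERIV_exp[unfolded has_field_derivative_def]])
      (intro C_k_mult Suc C_k_const)
qed (auto intro!: continuous_intros)

section \<open>The flat function exp(-1/x) and its relatives\<close>

definition flat_exp :: "nat \<Rightarrow> real \<Rightarrow> real" where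
  "flat_exp m x = (if 0 < x then inverse x ^ m * exp (- inverse x) else 0)"

lemma flat_exp_tendsto_0: "(flat_exp m \<longlongrightarrow> 0) (at 0)"
proof -
  have "((\<lambda>x::real. inverse x ^ m / exp (inverse x)) \<longlongrightarrow> 0) (at_right 0)"
    by (rule filterlim_compose[OF tendsto_power_div_exp_0 filterlim_inverse_at_top_right])
  then have "(flat_exp m \<longlongrightarrow> 0) (at_right 0)"
    by (rule Lim_transform_eventually)
      (auto simp: flat_exp_def eventually_at_filter exp_minus divide_inverse)
  moreover have "(flat_exp m \<longlongrightarrow> 0) (at_left 0)"
    by (rule Lim_transform_eventually[OF tendsto_const]) (auto simp: flat_exp_def eventually_at_filter)
  ultimately show ?thesis by (simp add: filterlim_split_at)
qed

text \<open>Differentiation maps the family into linear combinations of its own members. This is why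
  the power of \<open>inverse x\<close> is carried along: the induction for smoothness closes only
  for the whole family.\<close>

lemma flat_exp_has_derivative:
  "(flat_exp m has_real_derivative flat_exp (m + 2) x - real m * flat_exp (m + 1) x) (at x)"
proof -
  consider "x > 0" | "x < 0" | "x = 0" by linarith
  then show ?thesis
  proof cases
    case 1
    have "((\<lambda>x. inverse x ^ m * exp (- inverse x)) has_real_derivative
        flat_exp (m + 2) x - real m * flat_exp (m + 1) x) (at x)"
    proof -
      have *: "((\<lambda>x. inverse x ^ m) has_real_derivative - real m * inverse x ^ (m + 1)) (at x)"
        using DERIV_power[OF DERIV_inverse[of x], of m] 1
        by (cases m) (simp_all add: algebra_simps)
      have **: "((\<lambda>x. exp (- inverse x)) has_real_derivative exp (- inverse x) * inverse x ^ 2) (at x)"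
        using 1 by (auto intro!: derivative_eq_intros simp: power2_eq_square)
      show ?thesis
        using DERIV_mult[OF * **] 1 by (simp add: flat_exp_def algebra_simps power2_eq_square)
    qed
    moreover have "eventually (\<lambda>y. flat_exp m y = inverse y ^ m * exp (- inverse y)) (nhds x)"
      using eventually_nhds_in_open[of "{0<..}" x] 1
      by (auto simp: flat_exp_def elim!: eventually_mono)
    ultimately show ?thesis by (subst DERIV_cong_ev[OF refl _ refl]) auto
  next
    case 2
    have "eventually (\<lambda>y. flat_exp m y = 0) (nhds x)"
      using eventually_nhds_in_open[of "{..<0}" x] 2
      by (auto simp: flat_exp_def elim!: eventually_mono)
    with 2 show ?thesis by (subst DERIV_cong_ev[OF refl _ refl]) (auto simp: flat_exp_def)
  next
    case 3
    \<comment> \<open>At 0 the difference quotient of \<open>flat_exp m\<close> is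
      \<open>flat_exp (m + 1)\<close>, whose limit is already known.\<close>
    have "((\<lambda>y. (flat_exp m y - flat_exp m 0) / (y - 0)) \<longlongrightarrow> 0) (at 0)"
      by (rule Lim_transform_eventually[OF flat_exp_tendsto_0[of "m + 1"]])
        (auto simp: flat_exp_def eventually_at_filter divide_inverse)
    with 3 show ?thesis by (simp add: has_field_derivative_iff flat_exp_def)
  qed
qed

lemma C_k_flat_exp: "C_k k (flat_exp m)"
proof (induction k arbitrary: m)
  case 0
  then show ?case
    by (auto intro!: DERIV_continuous_on flat_exp_has_derivative)
next
  case (Suc k)
  show ?case
    by (rule C_k_SucI[OF flat_exp_has_derivative[unfolded has_field_derivative_def]])
      (intro C_k_mult C_k_diff C_k_const Suc)
qed

lemma flat_exp_bounds: "0 \<le> flat_exp 0 x" "flat_exp 0 x \<le> 1"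
  by (auto simp: flat_exp_def)

lemma flat_exp_pos_iff: "0 < flat_exp 0 x \<longleftrightarrow> 0 < x"
  by (auto simp: flat_exp_def)

text \<open>The limit at \<open>x = 0\<close> is 0, so the indicator obtained is that of the open
  half-line, as the approximation of open boxes demands.\<close>

lemma flat_exp_scaled_limit: "(\<lambda>n. flat_exp 0 (real n * x)) \<longlonglongrightarrow> (if 0 < x then 1 else 0)"
proof (cases "0 < x")
  case True
  have "filterlim (\<lambda>n. x * real n) at_top sequentially"
    using True by (intro filterlim_tendsto_pos_mult_at_top[OF tendsto_const] filterlim_real_sequentially)
  then have "filterlim (\<lambda>n. real n * x) at_top sequentially" by (simp add: mult.commute)
  then have "(\<lambda>n. exp (- inverse (real n * x))) \<longlonglongrightarrow> exp (- 0)"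
    by (intro tendsto_exp tendsto_minus tendsto_inverse_0_at_top)
  moreover have "eventually (\<lambda>n. exp (- inverse (real n * x)) = flat_exp 0 (real n * x)) sequentially"
    using eventually_gt_at_top[of 0] by eventually_elim (use True in \<open>auto simp: flat_exp_def\<close>)
  ultimately show ?thesis using True Lim_transform_eventually by fastforce
next
  case False
  then have "flat_exp 0 (real n * x) = 0" for n by (auto simp: flat_exp_def zero_less_mult_iff)
  with False show ?thesis by simp
qed

subsection \<open>The lemma of du Bois-Reymond\<close>

lemma C_k_affine_real: "C_k k (\<lambda>r::real. p + q * r)"
  by (intro C_k_add C_k_const C_k_linear bounded_linear_mult_right)

text \<open>The usual smooth transition: 1 + r and 1 - r are never both nonpositive, so the
  denominator is positive. Its derivative will serve as a mollifier.\<close>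

definition smooth_step :: "real \<Rightarrow> real" where
  "smooth_step r = flat_exp 0 (1 + r) * inverse (flat_exp 0 (1 + r) + flat_exp 0 (1 - r))"

lemma smooth_step_eq_0: "r \<le> -1 \<Longrightarrow> smooth_step r = 0"
  and smooth_step_eq_1: "1 \<le> r \<Longrightarrow> smooth_step r = 1"
  by (auto simp: smooth_step_def flat_exp_def)

lemma C_k_smooth_step: "C_k k smooth_step"
proof -
  have 1: "C_k k (\<lambda>r. flat_exp 0 (1 + 1 * r))" "C_k k (\<lambda>r. flat_exp 0 (1 + (-1) * r))"
    by (rule C_k_compose_real[OF C_k_flat_exp C_k_affine_real])+
  have "flat_exp 0 (1 + r) + flat_exp 0 (1 - r) \<noteq> 0" for r :: real
  proof -
    have "flat_exp 0 (1 + r) > 0 \<or> flat_exp 0 (1 - r) > 0" by (auto simp: flat_exp_pos_iff)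
    then show ?thesis
      using flat_exp_bounds(1)[of "1 + r"] flat_exp_bounds(1)[of "1 - r"] by linarith
  qed
  then show ?thesis
    unfolding smooth_step_def[abs_def] using 1
    by (intro C_k_mult C_k_inverse C_k_add) simp_all
qed

lemma C_k_real_derivative:
  fixes F :: "real \<Rightarrow> real"
  assumes "\<And>m. C_k m F"
  obtains F' where "\<And>r. (F has_real_derivative F' r) (at r)" "continuous_on UNIV F'"
proof
  show "(F has_real_derivative frechet_derivative F (at r) 1) (at r)" for r
  proof -
    have *: "(F has_derivative frechet_derivative F (at r)) (at r)"
      by (rule C_k_Suc_has_derivative[OF assms])
    have "frechet_derivative F (at r) = (*) (frechet_derivative F (at r) 1)"
    proof
      fix v
      show "frechet_derivative F (at r) v = frechet_derivative F (at r) 1 * v"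
        using linear_cmul[OF has_derivative_linear[OF *], of v 1]
        by (simp only: real_scaleR_def mult_1_right mult_1_left mult.commute)
    qed
    with * show ?thesis unfolding has_field_derivative_def by (rule has_derivative_eq_rhs)
  qed
  show "continuous_on UNIV (\<lambda>r. frechet_derivative F (at r) 1)"
    using assms[of "Suc 0"] by simp
qed

text \<open>The hypothesis expresses that \<open>c\<close> has vanishing distributional derivative
  on t > 0. It becomes an equality between a weighted mean of \<open>c\<close> near \<open>s\<close>
  and one near \<open>t\<close>; as the weights concentrate, the means tend to \<open>c s\<close>
  and \<open>c t\<close> by continuity.\<close>

lemma du_bois_reymond:
  fixes c :: "real \<Rightarrow> real"
  assumes cont: "continuous_on {0<..} c"
    and zero: "\<And>\<theta> \<theta>' p q. \<lbrakk>\<And>k. C_k k \<theta>; 0 < p; \<And>r. r \<notin> {p..q} \<Longrightarrow> \<theta> r = 0;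
        \<And>r. (\<theta> has_real_derivative \<theta>' r) (at r); continuous_on UNIV \<theta>'\<rbrakk>
      \<Longrightarrow> (LINT r:{0<..}|lborel. \<theta>' r * c r) = 0"
    and st: "0 < s" "s < t"
  shows "c s = c t"
proof -
  obtain N' where N': "\<And>r. (smooth_step has_real_derivative N' r) (at r)" "continuous_on UNIV N'"
    using C_k_real_derivative[OF C_k_smooth_step] by metis
  have N'_0: "N' r = 0" if "r \<notin> {-1..1}" for r
  proof -
    have "eventually (\<lambda>y. smooth_step y = smooth_step r) (nhds r)"
    proof (cases "r < -1")
      case True
      then show ?thesis using eventually_nhds_in_open[of "{..<-1}" r]
        by (auto elim!: eventually_mono simp: smooth_step_eq_0)
    next
      case False
      then show ?thesis using that eventually_nhds_in_open[of "{1<..}" r]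
        by (auto elim!: eventually_mono simp: smooth_step_eq_1)
    qed
    then have "(smooth_step has_real_derivative 0) (at r)"
      by (subst DERIV_cong_ev[OF refl _ refl]) auto
    then show ?thesis using DERIV_unique[OF N'(1)] by blast
  qed
  obtain K where K: "\<And>r. \<bar>N' r\<bar> \<le> K"
  proof -
    have "bounded (N' ` {-1..1})"
      using N'(2) by (intro compact_imp_bounded compact_continuous_image)
        (auto intro: continuous_on_subset)
    then obtain B where B: "\<And>r. r \<in> {-1..1} \<Longrightarrow> \<bar>N' r\<bar> \<le> B"
      unfolding bounded_iff by fastforce
    then have "\<bar>N' r\<bar> \<le> \<bar>B\<bar>" for r
      using N'_0[of r] order_trans[OF B abs_ge_self, of r] by (cases "r \<in> {-1..1}") auto
    then show ?thesis by (rule that)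
  qed
  \<comment> \<open>The mass of the mollifier is the total rise of \<open>smooth_step\<close>, hence
    1.\<close>
  have N'_int: "(\<integral>y. N' y \<partial>lborel) = 1"
  proof -
    have "(\<integral>y. N' y * indicator {-1..1} y \<partial>lborel) = smooth_step 1 - smooth_step (-1)"
      by (rule integral_FTC_Icc_real)
        (use N' in \<open>auto simp: continuous_on_eq_continuous_at\<close>)
    moreover have "N' y * indicator {-1..1} y = N' y" for y
      using N'_0[of y] by (auto simp: indicator_def)
    ultimately show ?thesis by (simp add: smooth_step_eq_0 smooth_step_eq_1)
  qed
  \<comment> \<open>A width of at most s/2 keeps the windows around \<open>s\<close> and
    \<open>t\<close> within the interval from s/2 to t + s, a compact set on which \<open>c\<close>
    is continuous and so bounded.\<close>
  define \<delta> where "\<delta> n = (s / 2) * inverse (real (Suc n))" for n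
  have \<delta>: "0 < \<delta> n" "\<delta> n \<le> s / 2" for n
    using st by (auto simp: \<delta>_def field_simps)
  have \<delta>_lim: "\<delta> \<longlonglongrightarrow> 0"
    unfolding \<delta>_def[abs_def] using tendsto_mult[OF tendsto_const LIMSEQ_inverse_real_of_nat, of "s/2"] by simp
  \<comment> \<open>Extension by zero: \<open>c\<close> is arbitrary outside t > 0, and the
    substitution below works with a Borel function on the whole line.\<close>
  define c0 where "c0 r = indicator {0<..} r *\<^sub>R c r" for r
  have [measurable]: "c0 \<in> borel_measurable borel"
    unfolding c0_def[abs_def] by (intro borel_measurable_continuous_on_indicator cont) simp
  have [measurable]: "N' \<in> borel_measurable borel"
    by (intro borel_measurable_continuous_onI N')
  obtain B where B: "\<And>r. r \<in> {s/2..t+s} \<Longrightarrow> \<bar>c0 r\<bar> \<le> B"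
  proof -
    have "bounded (c ` {s/2..t+s})"
      using cont st by (intro compact_imp_bounded compact_continuous_image)
        (auto intro: continuous_on_subset)
    then obtain B where "\<And>r. r \<in> {s/2..t+s} \<Longrightarrow> \<bar>c r\<bar> \<le> B"
      unfolding bounded_iff by fastforce
    then show ?thesis using st by (intro that[of B]) (auto simp: c0_def)
  qed
  have B0: "0 \<le> B" using B[of s] st by auto
  have bound: "\<bar>N' y * c0 (e + \<delta> n * y)\<bar> \<le> K * B * indicator {-1..1} y" if "e \<in> {s, t}" for e n y
  proof (cases "y \<in> {-1..1}")
    case True
    have "\<bar>\<delta> n * y\<bar> \<le> s / 2 * 1"
      unfolding abs_mult using True \<delta>[of n] st by (intro mult_mono) auto
    then have "\<bar>c0 (e + \<delta> n * y)\<bar> \<le> B"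
      using that st by (intro B) (auto simp: abs_le_iff)
    then show ?thesis using True K[of y] B0 by (auto simp: abs_mult intro!: mult_mono)
  qed (simp add: N'_0)
  have intK: "integrable lborel (\<lambda>y. K * B * indicator {-1..1::real} y)"
    by (intro integrable_mult_right integrable_real_indicator) auto
  have int: "integrable lborel (\<lambda>y. N' y * c0 (e + \<delta> n * y))" if "e \<in> {s, t}" for e n
    by (rule Bochner_Integration.integrable_bound[OF intK])
      (use order_trans[OF bound[OF that, of _ n] abs_ge_self] in simp_all)
  have lim: "(\<lambda>n. \<integral>y. N' y * c0 (e + \<delta> n * y) \<partial>lborel) \<longlonglongrightarrow> c e" if e: "e \<in> {s, t}" for e
  proof -
    have "(\<lambda>n. \<integral>y. N' y * c0 (e + \<delta> n * y) \<partial>lborel) \<longlonglongrightarrow> (\<integral>y. N' y * c e \<partial>lborel)"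
    proof (rule integral_dominated_convergence[OF _ _ intK])
      have "(\<lambda>n. c0 (e + \<delta> n * y)) \<longlonglongrightarrow> c e" for y
      proof -
        have "e > 0" using e st by auto
        have "isCont c e"
          using cont \<open>e > 0\<close> by (simp add: continuous_on_eq_continuous_at)
        moreover have "eventually (\<lambda>r. c r = c0 r) (nhds e)"
          using eventually_nhds_in_open[of "{0<..}" e] \<open>e > 0\<close>
          by (auto simp: c0_def elim!: eventually_mono)
        ultimately have "isCont c0 e" using isCont_cong by blast
        moreover have "(\<lambda>n. e + \<delta> n * y) \<longlonglongrightarrow> e + 0 * y"
          by (intro tendsto_intros \<delta>_lim)
        ultimately have "(\<lambda>n. c0 (e + \<delta> n * y)) \<longlonglongrightarrow> c0 e"
          by (intro isCont_tendsto_compose[of e c0]) auto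
        then show ?thesis using \<open>e > 0\<close> by (simp add: c0_def)
      qed
      then show "AE y in lborel. (\<lambda>n. N' y * c0 (e + \<delta> n * y)) \<longlonglongrightarrow> N' y * c e"
        by (intro AE_I2 tendsto_mult tendsto_const)
    qed (use bound[OF e] in auto)
    then show ?thesis using N'_int by simp
  qed
  have eq: "(\<integral>y. N' y * c0 (s + \<delta> n * y) \<partial>lborel) = (\<integral>y. N' y * c0 (t + \<delta> n * y) \<partial>lborel)" for n
  proof -
    \<comment> \<open>a smoothed indicator of the interval from \<open>s\<close> to \<open>t\<close>, so that its derivative
        tests \<open>c\<close> near \<open>s\<close> against \<open>c\<close> near \<open>t\<close>\<close>
    define \<theta> where "\<theta> r = smooth_step (- s / \<delta> n + (1 / \<delta> n) * r) - smooth_step (- t / \<delta> n + (1 / \<delta> n) * r)" for r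
    define \<theta>' where "\<theta>' r = N' (- s / \<delta> n + (1 / \<delta> n) * r) / \<delta> n - N' (- t / \<delta> n + (1 / \<delta> n) * r) / \<delta> n" for r
    have "(LINT r:{0<..}|lborel. \<theta>' r * c r) = 0"
    proof (rule zero)
      show "C_k k \<theta>" for k
        unfolding \<theta>_def[abs_def]
        by (intro C_k_diff C_k_compose_real[OF C_k_smooth_step C_k_affine_real])
      show "0 < s / 2" using st by simp
      show "\<theta> r = 0" if "r \<notin> {s/2..t+s}" for r
      proof -
        have ineq: "- e / \<delta> n + (1 / \<delta> n) * r = (r - e) / \<delta> n" for e
          by (simp add: diff_divide_distrib)
        from that consider "r < s / 2" | "r > t + s" by fastforce
        then show ?thesis
        proof cases
          case 1
          then have "(r - s) / \<delta> n \<le> -1" "(r - t) / \<delta> n \<le> -1"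
            using \<delta>[of n] st by (auto simp: field_simps)
          then show ?thesis unfolding \<theta>_def ineq by (simp only: smooth_step_eq_0 diff_self)
        next
          case 2
          then have "(r - s) / \<delta> n \<ge> 1" "(r - t) / \<delta> n \<ge> 1"
            using \<delta>[of n] st by (auto simp: field_simps)
          then show ?thesis unfolding \<theta>_def ineq by (simp only: smooth_step_eq_1 diff_self)
        qed
      qed
      show "(\<theta> has_real_derivative \<theta>' r) (at r)" for r
        unfolding \<theta>_def[abs_def] \<theta>'_def
      proof -
        have "((\<lambda>r. smooth_step (- e / \<delta> n + (1 / \<delta> n) * r)) has_real_derivative
            N' (- e / \<delta> n + (1 / \<delta> n) * r) * (1 / \<delta> n)) (at r)" for e
          by (rule DERIV_chain2[OF N'(1)])
            (use \<delta>(1)[of n] in \<open>auto intro!: derivative_eq_intros\<close>)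
        from DERIV_diff[OF this[of s] this[of t]]
        show "((\<lambda>r. smooth_step (- s / \<delta> n + (1 / \<delta> n) * r) - smooth_step (- t / \<delta> n + (1 / \<delta> n) * r))
            has_real_derivative N' (- s / \<delta> n + (1 / \<delta> n) * r) / \<delta> n - N' (- t / \<delta> n + (1 / \<delta> n) * r) / \<delta> n) (at r)"
          by simp
      qed
      show "continuous_on UNIV \<theta>'"
        unfolding \<theta>'_def[abs_def] using \<delta>[of n]
        by (intro continuous_intros continuous_on_compose2[OF N'(2)]) auto
    qed
    \<comment> \<open>Substitution r = e + \<delta> n * y; the factor 1/\<delta> n in \<theta>'
      cancels the Jacobian.\<close>
    moreover have subst: "integrable lborel (\<lambda>r. N' (- e / \<delta> n + (1 / \<delta> n) * r) / \<delta> n * c0 r)"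
       "(\<integral>r. N' (- e / \<delta> n + (1 / \<delta> n) * r) / \<delta> n * c0 r \<partial>lborel) = (\<integral>y. N' y * c0 (e + \<delta> n * y) \<partial>lborel)"
      if "e \<in> {s, t}" for e
    proof -
      have arg: "- e / \<delta> n + (1 / \<delta> n) * (e + \<delta> n * y) = y" for y
        using \<delta>[of n] by (simp add: field_simps)
      show "integrable lborel (\<lambda>r. N' (- e / \<delta> n + (1 / \<delta> n) * r) / \<delta> n * c0 r)"
        using int[OF that, of n] \<delta>[of n]
        by (subst lborel_integrable_real_affine_iff[symmetric, of "\<delta> n" _ e])
          (simp_all only: arg, simp_all add: times_divide_eq_left)
      show "(\<integral>r. N' (- e / \<delta> n + (1 / \<delta> n) * r) / \<delta> n * c0 r \<partial>lborel) = (\<integral>y. N' y * c0 (e + \<delta> n * y) \<partial>lborel)"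
        using \<delta>[of n]
        by (subst lborel_integral_real_affine[of "\<delta> n" _ e])
          (simp_all only: arg, simp_all add: times_divide_eq_left)
    qed
    moreover have "(LINT r:{0<..}|lborel. \<theta>' r * c r) =
       (\<integral>r. N' (- s / \<delta> n + (1 / \<delta> n) * r) / \<delta> n * c0 r - N' (- t / \<delta> n + (1 / \<delta> n) * r) / \<delta> n * c0 r \<partial>lborel)"
      unfolding set_lebesgue_integral_def
      by (intro Bochner_Integration.integral_cong) (auto simp: \<theta>'_def c0_def algebra_simps)
    ultimately show ?thesis by (simp add: Bochner_Integration.integral_diff)
  qed
  from lim[of s] lim[of t] show ?thesis
    unfolding eq by (auto intro: LIMSEQ_unique)
qed

subsection \<open>Curves in L1 paired with bounded functions\<close>

lemma integrable_mult_bounded: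
  fixes g k :: "'a::euclidean_space \<Rightarrow> real"
  assumes g: "integrable lborel g" and k: "k \<in> borel_measurable borel"
    and bound: "AE z in lborel. \<bar>k z\<bar> \<le> C"
  shows "integrable lborel (\<lambda>z. g z * k z)"
    and "\<bar>\<integral>z. g z * k z \<partial>lborel\<bar> \<le> C * L1_norm g"
proof -
  have le: "AE z in lborel. \<bar>g z * k z\<bar> \<le> \<bar>g z\<bar> * C"
    using bound by eventually_elim (simp add: abs_mult mult_left_mono)
  have gC: "integrable lborel (\<lambda>z. \<bar>g z\<bar> * C)"
    using g by simp
  show int: "integrable lborel (\<lambda>z. g z * k z)"
  proof (rule Bochner_Integration.integrable_bound[OF gC])
    show "(\<lambda>z. g z * k z) \<in> borel_measurable lborel"
      using g k by (auto intro!: borel_measurable_times)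
    show "AE z in lborel. norm (g z * k z) \<le> norm (\<bar>g z\<bar> * C)"
      using le by eventually_elim (simp only: real_norm_def order_trans[OF _ abs_ge_self])
  qed
  have "\<bar>\<integral>z. g z * k z \<partial>lborel\<bar> \<le> (\<integral>z. \<bar>g z * k z\<bar> \<partial>lborel)"
    by (rule integral_abs_bound)
  also have "\<dots> \<le> (\<integral>z. \<bar>g z\<bar> * C \<partial>lborel)"
    by (intro integral_mono_AE integrable_abs int gC le)
  finally show "\<bar>\<integral>z. g z * k z \<partial>lborel\<bar> \<le> C * L1_norm g"
    by (simp add: L1_norm_def mult.commute)
qed

text \<open>The increment splits into (g_s - g_t) k_s, small by L1 continuity and the uniform bound
  on \<open>k\<close>, and g_t (k_s - k_t), where g_t is fixed and dominated convergence applies.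
  The bound holds only almost everywhere because \<open>k\<close> will contain \<open>a\<close>;
  continuity in time holds at every point, as \<open>a\<close> does not depend on time.\<close>

lemma pairing_continuous:
  fixes g :: "real \<Rightarrow> 'a::euclidean_space \<Rightarrow> real"
  assumes g: "cont_L1 I g"
    and meas: "\<And>t. t \<in> I \<Longrightarrow> k t \<in> borel_measurable borel"
    and bound: "\<And>t. t \<in> I \<Longrightarrow> AE z in lborel. \<bar>k t z\<bar> \<le> C"
    and cont: "\<And>z. continuous_on I (\<lambda>t. k t z)"
  shows "continuous_on I (\<lambda>t. \<integral>z. g t z * k t z \<partial>lborel)"
proof (rule continuous_on_sequentiallyI)
  fix s :: "nat \<Rightarrow> real" and t
  assume s: "\<forall>n. s n \<in> I" and t: "t \<in> I" and lim: "s \<longlonglongrightarrow> t"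
  have g_int: "integrable lborel (g r)" if "r \<in> I" for r
    using g that by (auto simp: cont_L1_def)
  have s_I: "s n \<in> I" for n using s by simp
  note k_s = meas[OF s_I] bound[OF s_I]
  have diff_int: "integrable lborel (\<lambda>z. g (s n) z - g t z)" for n
    by (intro Bochner_Integration.integrable_diff g_int s_I t)
  have split: "(\<integral>z. g (s n) z * k (s n) z \<partial>lborel) =
      (\<integral>z. (g (s n) z - g t z) * k (s n) z \<partial>lborel) + (\<integral>z. g t z * k (s n) z \<partial>lborel)" for n
    using Bochner_Integration.integral_add[OF integrable_mult_bounded(1)[OF diff_int[of n] k_s[of n]]
        integrable_mult_bounded(1)[OF g_int[OF t] k_s[of n]]]
    by (simp add: algebra_simps)
  have "(\<lambda>n. \<integral>z. (g (s n) z - g t z) * k (s n) z \<partial>lborel) \<longlonglongrightarrow> 0"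
  proof (rule tendsto_rabs_zero_cancel, rule real_tendsto_sandwich[OF _ _ tendsto_const])
    show "\<forall>\<^sub>F n in sequentially. \<bar>\<integral>z. (g (s n) z - g t z) * k (s n) z \<partial>lborel\<bar>
        \<le> C * L1_norm (\<lambda>z. g (s n) z - g t z)"
      by (intro always_eventually allI integrable_mult_bounded(2) diff_int k_s)
    have "((\<lambda>r. L1_norm (\<lambda>z. g r z - g t z)) \<longlongrightarrow> 0) (at t within I)"
      using g t by (auto simp: cont_L1_def)
    \<comment> \<open>\<open>cont_L1\<close> gives a limit with \<open>t\<close> removed, whereas
      the sequence may hit \<open>t\<close>. The value at \<open>t\<close> is 0, which turns the
      limit into continuity.\<close>
    moreover have "L1_norm (\<lambda>z. g t z - g t z) = 0" by (simp add: L1_norm_def)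
    ultimately have "continuous (at t within I) (\<lambda>r. L1_norm (\<lambda>z. g r z - g t z))"
      by (simp add: continuous_within)
    then have "(\<lambda>n. L1_norm (\<lambda>z. g (s n) z - g t z)) \<longlonglongrightarrow> L1_norm (\<lambda>z. g t z - g t z)"
      using s lim unfolding continuous_within_sequentially by (auto simp: o_def)
    then have "(\<lambda>n. C * L1_norm (\<lambda>z. g (s n) z - g t z)) \<longlonglongrightarrow> C * L1_norm (\<lambda>z. g t z - g t z)"
      by (intro tendsto_mult tendsto_const)
    then show "(\<lambda>n. C * L1_norm (\<lambda>z. g (s n) z - g t z)) \<longlonglongrightarrow> 0"
      by (simp add: L1_norm_def)
  qed auto
  moreover have "(\<lambda>n. \<integral>z. g t z * k (s n) z \<partial>lborel) \<longlonglongrightarrow> (\<integral>z. g t z * k t z \<partial>lborel)"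
  proof (rule integral_dominated_convergence[where w = "\<lambda>z. \<bar>g t z\<bar> * C"])
    show "integrable lborel (\<lambda>z. \<bar>g t z\<bar> * C)" using g_int[OF t] by simp
    have "(\<lambda>n. k (s n) z) \<longlonglongrightarrow> k t z" for z
      using cont[of z] s t lim unfolding continuous_on_sequentially by (auto simp: o_def)
    then show "AE z in lborel. (\<lambda>n. g t z * k (s n) z) \<longlonglongrightarrow> g t z * k t z"
      by (intro AE_I2 tendsto_mult tendsto_const)
    show "AE z in lborel. norm (g t z * k (s n) z) \<le> \<bar>g t z\<bar> * C" for n
      using k_s(2)[of n] by eventually_elim (simp add: abs_mult mult_left_mono)
    show "(\<lambda>z. g t z * k t z) \<in> borel_measurable lborel"
      using g_int[OF t] meas[OF t] by (auto intro!: borel_measurable_times)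
    show "(\<lambda>z. g t z * k (s n) z) \<in> borel_measurable lborel" for n
      using g_int[OF t] k_s(1)[of n] by (auto intro!: borel_measurable_times)
  qed
  ultimately show "(\<lambda>n. \<integral>z. g (s n) z * k (s n) z \<partial>lborel) \<longlonglongrightarrow> (\<integral>z. g t z * k t z \<partial>lborel)"
    unfolding split using tendsto_add by force
qed

text \<open>The norm is continuous in time by the reverse triangle inequality, hence bounded on
  compact intervals. The bound later dominates the integrands in time.\<close>

lemma cont_L1_norm_bounded:
  assumes g: "cont_L1 I g" and I: "{p..q} \<subseteq> I"
  obtains G where "\<And>t. t \<in> {p..q} \<Longrightarrow> L1_norm (g t) \<le> G"
proof -
  have int: "integrable lborel (g t)" if "t \<in> I" for t
    using g that by (auto simp: cont_L1_def)
  have diff: "\<bar>L1_norm (g s) - L1_norm (g t)\<bar> \<le> L1_norm (\<lambda>z. g s z - g t z)" if "s \<in> I" "t \<in> I" for s t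
  proof -
    have "L1_norm (g s) - L1_norm (g t) = (\<integral>z. \<bar>g s z\<bar> - \<bar>g t z\<bar> \<partial>lborel)"
      unfolding L1_norm_def using int that by (simp add: Bochner_Integration.integral_diff)
    also have "\<bar>\<dots>\<bar> \<le> (\<integral>z. \<bar>\<bar>g s z\<bar> - \<bar>g t z\<bar>\<bar> \<partial>lborel)" by (rule integral_abs_bound)
    also have "\<dots> \<le> L1_norm (\<lambda>z. g s z - g t z)"
      unfolding L1_norm_def using int that by (intro integral_mono) auto
    finally show ?thesis .
  qed
  have "continuous_on I (\<lambda>t. L1_norm (g t))"
    unfolding continuous_on_def
  proof
    fix t assume t: "t \<in> I"
    have lim: "((\<lambda>s. L1_norm (\<lambda>z. g s z - g t z)) \<longlongrightarrow> 0) (at t within I)"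
      using g t by (auto simp: cont_L1_def)
    have le: "\<forall>\<^sub>F s in at t within I. \<bar>L1_norm (g s) - L1_norm (g t)\<bar> \<le> L1_norm (\<lambda>z. g s z - g t z)"
      using diff t by (auto simp: eventually_at_filter)
    have "((\<lambda>s. \<bar>L1_norm (g s) - L1_norm (g t)\<bar>) \<longlongrightarrow> 0) (at t within I)"
      by (rule real_tendsto_sandwich[OF _ le tendsto_const lim]) simp
    then show "((\<lambda>t. L1_norm (g t)) \<longlongrightarrow> L1_norm (g t)) (at t within I)"
      by (rule LIM_zero_cancel[OF tendsto_rabs_zero_cancel])
  qed
  then have "bounded ((\<lambda>t. L1_norm (g t)) ` {p..q})"
    using I by (intro compact_imp_bounded compact_continuous_image)
      (auto intro: continuous_on_subset)
  then obtain G where "\<And>t. t \<in> {p..q} \<Longrightarrow> \<bar>L1_norm (g t)\<bar> \<le> G"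
    unfolding bounded_iff by fastforce
  then show thesis by (intro that[of G]) (auto simp: abs_le_iff)
qed

lemma cont_L1_diff:
  assumes "cont_L1 I f" "cont_L1 I g"
  shows "cont_L1 I (\<lambda>t z. f t z - g t z)"
proof -
  have int: "integrable lborel (f t)" "integrable lborel (g t)" if "t \<in> I" for t
    using assms that by (auto simp: cont_L1_def)
  have "((\<lambda>s. L1_norm (\<lambda>z. (f s z - g s z) - (f t z - g t z))) \<longlongrightarrow> 0) (at t within I)" if t: "t \<in> I" for t
  proof (rule real_tendsto_sandwich[OF _ _ tendsto_const])
    have "((\<lambda>s. L1_norm (\<lambda>z. f s z - f t z) + L1_norm (\<lambda>z. g s z - g t z)) \<longlongrightarrow> 0 + 0) (at t within I)"
      using assms t by (intro tendsto_add) (auto simp: cont_L1_def)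
    then show "((\<lambda>s. L1_norm (\<lambda>z. f s z - f t z) + L1_norm (\<lambda>z. g s z - g t z)) \<longlongrightarrow> 0) (at t within I)"
      by simp
    have "L1_norm (\<lambda>z. (f s z - g s z) - (f t z - g t z))
        \<le> L1_norm (\<lambda>z. f s z - f t z) + L1_norm (\<lambda>z. g s z - g t z)" if "s \<in> I" for s
    proof -
      have fi: "integrable lborel (\<lambda>z. \<bar>f s z - f t z\<bar>)"
        by (intro integrable_abs Bochner_Integration.integrable_diff int t that)
      have gi: "integrable lborel (\<lambda>z. \<bar>g s z - g t z\<bar>)"
        by (intro integrable_abs Bochner_Integration.integrable_diff int t that)
      have "(\<integral>z. \<bar>(f s z - g s z) - (f t z - g t z)\<bar> \<partial>lborel)
          \<le> (\<integral>z. \<bar>f s z - f t z\<bar> + \<bar>g s z - g t z\<bar> \<partial>lborel)"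
        by (intro integral_mono Bochner_Integration.integrable_add fi gi integrable_abs
            Bochner_Integration.integrable_diff int t that) linarith
      then show ?thesis
        unfolding L1_norm_def Bochner_Integration.integral_add[OF fi gi] .
    qed
    then show "\<forall>\<^sub>F s in at t within I. L1_norm (\<lambda>z. (f s z - g s z) - (f t z - g t z))
        \<le> L1_norm (\<lambda>z. f s z - f t z) + L1_norm (\<lambda>z. g s z - g t z)"
      by (auto simp: eventually_at_filter)
  qed (auto simp: L1_norm_def)
  then show ?thesis using int by (auto simp: cont_L1_def)
qed

lemma cont_L1_atLeast:
  assumes "\<And>T. T > 0 \<Longrightarrow> cont_L1 {0..T} g"
  shows "cont_L1 {0..} g"
  unfolding cont_L1_def
proof (intro conjI ballI)
  fix t :: real assume t: "t \<in> {0..}"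
  \<comment> \<open>The extra 1 makes the interval a neighbourhood of \<open>t\<close> relative to
    the half-line, so the two punctured filters agree.\<close>
  then have *: "cont_L1 {0..t+1} g" by (intro assms) auto
  then show "integrable lborel (g t)" using t by (auto simp: cont_L1_def)
  have "at t within {0..} = at t within {0..t+1}"
    by (rule at_within_nhd[of t "{..<t+1}"]) auto
  then show "((\<lambda>s. L1_norm (\<lambda>z. g s z - g t z)) \<longlongrightarrow> 0) (at t within {0..})"
    using * t by (auto simp: cont_L1_def)
qed

section \<open>Approximation of the velocity\<close>

lemma AE_snd_lborel:
  assumes "AE \<xi> in lborel. P \<xi>"
  shows "AE z in (lborel :: ('a::euclidean_space \<times> 'b::euclidean_space) measure). P (snd z)"
proof -
  obtain N where N: "N \<in> null_sets lborel" "{\<xi>. \<not> P \<xi>} \<subseteq> N"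
    using assms unfolding eventually_ae_filter by auto
  have "UNIV \<times> N \<in> null_sets (lborel \<Otimes>\<^sub>M (lborel :: 'b measure) :: ('a \<times> 'b) measure)"
    using N(1) by (auto simp: null_sets_def lborel.emeasure_pair_measure_Times intro!: pair_measureI)
  then have "UNIV \<times> N \<in> null_sets (lborel :: ('a \<times> 'b) measure)"
    by (simp add: lborel_prod)
  then show ?thesis by (rule AE_I') (use N(2) in auto)
qed

text \<open>A measurable function is an almost everywhere limit of continuous functions, but without
  a common bound. Composing these with the projection onto a closed ball that contains almost all
  values of \<open>a\<close> over the interval restores the bound and keeps the limit;
  Stone-Weierstrass then replaces them by polynomials.\<close>

lemma polynomial_approximation_AE:
  fixes a :: "real \<Rightarrow> 'b::euclidean_space"
  assumes "Linf_loc a"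
  obtains p C where "\<And>n. polynomial_function (p n)" "0 \<le> C"
    "\<And>n \<xi>. \<xi> \<in> {-r..r} \<Longrightarrow> norm (p n \<xi>) \<le> C"
    "AE \<xi> in lborel. \<xi> \<in> {-r..r} \<longrightarrow> norm (a \<xi>) \<le> C"
    "AE \<xi> in lborel. \<xi> \<in> {-r..r} \<longrightarrow> (\<lambda>n::nat. p n \<xi>) \<longlonglongrightarrow> a \<xi>"
proof -
  obtain C0 where C0: "AE \<xi> in lborel. \<xi> \<in> {-r..r} \<longrightarrow> norm (a \<xi>) \<le> C0"
    using assms unfolding Linf_loc_def by (meson compact_Icc)
  \<comment> \<open>The absolute value keeps the ball nonempty, so that the closest point
    exists.\<close>
  define C where "C = \<bar>C0\<bar>"
  have C: "AE \<xi> in lborel. \<xi> \<in> {-r..r} \<longrightarrow> norm (a \<xi>) \<le> C"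
    using C0 by eventually_elim (auto simp: C_def)
  have "a \<in> borel_measurable (completion lborel)"
    using assms by (intro measurable_completion) (auto simp: Linf_loc_def)
  then have "a measurable_on UNIV"
    using lebesgue_measurable_imp_measurable_on[of a UNIV] by simp
  then obtain N g where N: "negligible N" and g: "\<And>n. continuous_on UNIV (g n)"
    and lim: "\<And>\<xi>. \<xi> \<notin> N \<Longrightarrow> (\<lambda>n. g n \<xi>) \<longlonglongrightarrow> a \<xi>"
    unfolding measurable_on_def by auto
  define cl where "cl = closest_point (cball (0::'b) C)"
  have cl_cont: "continuous_on UNIV cl"
    unfolding cl_def by (intro continuous_on_closest_point) (auto simp: C_def)
  have cl_norm: "norm (cl y) \<le> C" for y
    using closest_point_in_set[of "cball (0::'b) C" y] by (simp add: cl_def C_def)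
  have cl_self: "cl y = y" if "norm y \<le> C" for y
    using that by (simp add: cl_def closest_point_self)
  have "\<exists>q. polynomial_function q \<and> (\<forall>\<xi>\<in>{-r..r}. norm (cl (g n \<xi>) - q \<xi>) < inverse (real (Suc n)))" for n
    by (intro Stone_Weierstrass_polynomial_function)
      (auto intro!: continuous_on_compose2[OF cl_cont] continuous_on_subset[OF g])
  then obtain p where p: "\<And>n. polynomial_function (p n)"
    and close: "\<And>n \<xi>. \<xi> \<in> {-r..r} \<Longrightarrow> norm (cl (g n \<xi>) - p n \<xi>) < inverse (real (Suc n))"
    by metis
  \<comment> \<open>The added 1 absorbs the error of the polynomials; C + 1 is the constant finally
    handed out.\<close>
  have p_norm: "norm (p n \<xi>) \<le> C + 1" if "\<xi> \<in> {-r..r}" for n \<xi>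
  proof -
    have "inverse (real (Suc n)) \<le> 1" by (simp add: field_simps)
    then show ?thesis
      using close[OF that, of n] cl_norm[of "g n \<xi>"] norm_triangle_sub[of "p n \<xi>" "cl (g n \<xi>)"]
      by (simp add: norm_minus_commute)
  qed
  have "AE \<xi> in lebesgue. \<xi> \<notin> N"
    using N by (intro AE_not_in) (simp add: negligible_iff_null_sets)
  then have "AE \<xi> in lborel. \<xi> \<notin> N" by (simp add: AE_completion_iff)
  then have conv: "AE \<xi> in lborel. \<xi> \<in> {-r..r} \<longrightarrow> (\<lambda>n. p n \<xi>) \<longlonglongrightarrow> a \<xi>"
    using C
  proof eventually_elim
    case (elim \<xi>)
    show ?case
    proof
      assume \<xi>: "\<xi> \<in> {-r..r}"
      have "(\<lambda>n. cl (g n \<xi>)) \<longlonglongrightarrow> cl (a \<xi>)"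
        using lim[OF elim(1)] cl_cont continuous_on_tendsto_compose[of UNIV cl] by auto
      moreover have "(\<lambda>n. cl (g n \<xi>) - p n \<xi>) \<longlonglongrightarrow> 0"
        by (rule Lim_null_comparison[OF _ LIMSEQ_inverse_real_of_nat])
          (use close[OF \<xi>] in \<open>auto intro!: always_eventually less_imp_le\<close>)
      ultimately have "(\<lambda>n. cl (g n \<xi>) - (cl (g n \<xi>) - p n \<xi>)) \<longlonglongrightarrow> cl (a \<xi>) - 0"
        by (rule tendsto_diff)
      then show "(\<lambda>n. p n \<xi>) \<longlonglongrightarrow> a \<xi>"
        using elim(2) \<xi> cl_self by simp
    qed
  qed
  have "AE \<xi> in lborel. \<xi> \<in> {-r..r} \<longrightarrow> norm (a \<xi>) \<le> C + 1"
    using C by eventually_elim auto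
  from that[OF p _ p_norm this conv] show thesis by (simp add: C_def)
qed

subsection \<open>Test functions along approximate characteristics\<close>

lemma has_derivative_zero_outside:
  assumes f: "(f has_derivative f') (at x)" and S: "closed S" "\<And>y. y \<notin> S \<Longrightarrow> f y = 0" "x \<notin> S"
  shows "f' = (\<lambda>v. 0)"
proof (rule has_derivative_unique[OF f])
  show "(f has_derivative (\<lambda>v. 0)) (at x)"
    by (rule has_derivative_transform_within_open[OF has_derivative_const[of 0], of "- S"])
      (use S in \<open>auto simp: open_Compl\<close>)
qed

lemma DERIV_zero_outside:
  fixes \<theta> :: "real \<Rightarrow> real"
  assumes "(\<theta> has_real_derivative D) (at t)" "\<And>t. t \<notin> {s..T} \<Longrightarrow> \<theta> t = 0" "t \<notin> {s..T}"
  shows "D = 0"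
proof -
  have "(*) D = (\<lambda>v. 0)"
    by (rule has_derivative_zero_outside[OF assms(1)[unfolded has_field_derivative_def] _ assms(2,3)]) simp
  from fun_cong[OF this, of 1] show ?thesis by simp
qed

lemma continuous_compact_support_bounded:
  fixes f :: "'a::euclidean_space \<Rightarrow> real"
  assumes "continuous_on UNIV f" "compact S" "\<And>x. x \<notin> S \<Longrightarrow> f x = 0"
  shows "\<exists>B\<ge>0. \<forall>x. \<bar>f x\<bar> \<le> B"
proof -
  have "bounded (f ` S)"
    using assms by (intro compact_imp_bounded compact_continuous_image)
      (auto intro: continuous_on_subset)
  then obtain B where B: "\<And>x. x \<in> S \<Longrightarrow> \<bar>f x\<bar> \<le> B"
    unfolding bounded_iff by fastforce
  have "\<bar>f x\<bar> \<le> \<bar>B\<bar>" for x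
    using assms(3)[of x] order_trans[OF B abs_ge_self, of x] by (cases "x \<in> S") auto
  then show ?thesis by (intro exI[of _ "\<bar>B\<bar>"]) simp
qed

text \<open>By linearity a derivative is controlled by its values on \<open>Basis\<close>, each of
  which is continuous with compact support. A single constant then serves \<open>R\<close> and its
  derivative.\<close>

lemma C_k_compact_support_bounds:
  fixes R :: "'a::euclidean_space \<Rightarrow> real"
  assumes R: "\<And>m. C_k m R" and supp: "\<And>z. r < norm z \<Longrightarrow> R z = 0"
  obtains K R' where "0 \<le> K" "\<And>z. \<bar>R z\<bar> \<le> K" "\<And>z. (R has_derivative R' z) (at z)"
    "\<And>v. continuous_on UNIV (\<lambda>z. R' z v)" "\<And>z v. \<bar>R' z v\<bar> \<le> K * norm v"
    "\<And>z v. r < norm z \<Longrightarrow> R' z v = 0"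
proof -
  define R' where "R' z = frechet_derivative R (at z)" for z
  have der: "(R has_derivative R' z) (at z)" for z
    unfolding R'_def by (rule C_k_Suc_has_derivative[OF R])
  have cont: "continuous_on UNIV (\<lambda>z. R' z v)" for v
    unfolding R'_def using R[of "Suc 0"] by simp
  have zero: "R' z v = 0" if "r < norm z" for z v
  proof -
    have "R' z = (\<lambda>v. 0)"
      by (rule has_derivative_zero_outside[OF der closed_cball[of 0 r]]) (use supp that in auto)
    then show ?thesis by simp
  qed
  have out: "r < norm z" if "z \<notin> cball 0 r" for z :: 'a using that by simp
  obtain K0 where K0: "\<And>z. \<bar>R z\<bar> \<le> K0" "0 \<le> K0"
    using continuous_compact_support_bounded[OF C_k_imp_continuous[OF R] compact_cball supp[OF out]]
    by blast
  have "\<exists>B. \<forall>z. \<bar>R' z j\<bar> \<le> B" for j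
    using continuous_compact_support_bounded[OF cont compact_cball zero[OF out]] by blast
  then obtain B where B: "\<And>z j. \<bar>R' z j\<bar> \<le> B j" by metis
  define K where "K = max K0 (\<Sum>j\<in>Basis. B j)"
  have "\<bar>R' z v\<bar> \<le> K * norm v" for z v
  proof -
    interpret linear "R' z" by (rule has_derivative_linear[OF der])
    have "R' z v = R' z (\<Sum>j\<in>Basis. (v \<bullet> j) *\<^sub>R j)" by (simp add: euclidean_representation)
    also have "\<dots> = (\<Sum>j\<in>Basis. (v \<bullet> j) * R' z j)" by (simp add: sum scale)
    also have "\<bar>\<dots>\<bar> \<le> (\<Sum>j\<in>Basis. norm v * B j)"
      by (intro order_trans[OF sum_abs] sum_mono)
        (auto simp: abs_mult intro!: mult_mono Basis_le_norm B)
    also have "\<dots> = (\<Sum>j\<in>Basis. B j) * norm v" by (simp add: sum_distrib_left sum_distrib_right mult.commute)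
    also have "\<dots> \<le> K * norm v" by (intro mult_right_mono) (auto simp: K_def)
    finally show ?thesis .
  qed
  moreover have "\<bar>R z\<bar> \<le> K" for z using K0(1)[of z] by (simp add: K_def)
  moreover have "0 \<le> K" using K0 by (simp add: K_def)
  ultimately show thesis using der cont zero by (intro that[of K R'])
qed

lemma set_integrable_Ioi:
  fixes F :: "real \<Rightarrow> real"
  assumes "continuous_on {0..} F" "0 < p" "\<And>t. t \<notin> {p..q} \<Longrightarrow> F t = 0"
  shows "set_integrable lborel {0<..} F"
proof -
  have "set_integrable lborel {p..q} F"
    by (rule borel_integrable_atLeastAtMost') (use assms in \<open>auto intro: continuous_on_subset\<close>)
  moreover have "(\<lambda>t. indicator {0<..} t *\<^sub>R F t) = (\<lambda>t. indicator {p..q} t *\<^sub>R F t)"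
    using assms(2,3) by (auto simp: indicator_def fun_eq_iff)
  ultimately show ?thesis by (simp only: set_integrable_def)
qed

text \<open>A polynomial velocity makes the composition smooth in \<xi>. The support stays compact
  although the curves spread: \<open>R\<close> confines \<xi> to a bounded interval on which
  \<open>p\<close> is bounded, so up to time \<open>T\<close> a point moves by at most T times that
  bound.\<close>

lemma test_function_along_curves:
  fixes p :: "real \<Rightarrow> real ^ 'n::finite" and R :: "(real ^ 'n) \<times> real \<Rightarrow> real"
  assumes E: "\<And>k. C_k k E" "0 < s" "\<And>t. t \<notin> {s..T} \<Longrightarrow> E t = 0"
    and p: "polynomial_function p"
    and R: "\<And>k. C_k k R" "\<And>z. r < norm z \<Longrightarrow> R z = 0"
  shows "test_function ({0<..} \<times> UNIV)
    (\<lambda>w. E (fst w) * R (fst (snd w) - fst w *\<^sub>R p (snd (snd w)), snd (snd w)))"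
    (is "test_function _ ?\<phi>")
  unfolding test_function_def
proof (intro conjI allI)
  fix k
  have p_comp: "C_k k (\<lambda>\<xi>. p \<xi> \<bullet> v)" for k v
  proof -
    have "real_polynomial_function ((\<lambda>y. y \<bullet> v) \<circ> p)"
      using p bounded_linear_inner_left unfolding polynomial_function_def by blast
    then show ?thesis using C_k_polynomial by (auto simp: o_def)
  qed
  have lin: "bounded_linear (\<lambda>w::real \<times> (real ^ 'n) \<times> real. fst w)"
    "bounded_linear (\<lambda>w::real \<times> (real ^ 'n) \<times> real. snd (snd w))"
    "bounded_linear (\<lambda>w::real \<times> (real ^ 'n) \<times> real. fst (snd w) \<bullet> v)" for v
    by (intro bounded_linear_fst bounded_linear_compose[OF bounded_linear_snd]
        bounded_linear_compose[OF bounded_linear_fst] bounded_linear_snd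
        bounded_linear_compose[OF bounded_linear_inner_left])+
  have "C_k k (\<lambda>w::real \<times> (real ^ 'n) \<times> real. R (fst (snd w) - fst w *\<^sub>R p (snd (snd w)), snd (snd w)))"
  proof (rule C_k_compose[OF R(1)])
    fix j :: "(real ^ 'n) \<times> real"
    have "C_k k (\<lambda>w::real \<times> (real ^ 'n) \<times> real. (fst (snd w) \<bullet> fst j - fst w * (p (snd (snd w)) \<bullet> fst j)) + snd (snd w) * snd j)"
      by (intro C_k_add C_k_diff C_k_mult C_k_const C_k_linear lin C_k_compose_linear[OF p_comp])
    then show "C_k k (\<lambda>w::real \<times> (real ^ 'n) \<times> real. (fst (snd w) - fst w *\<^sub>R p (snd (snd w)), snd (snd w)) \<bullet> j)"
      by (simp add: inner_prod_def inner_diff_left)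
  qed
  then show "C_k k ?\<phi>"
    by (intro C_k_mult C_k_compose_linear[OF E(1)] lin)
next
  have "bounded (p ` {-r..r})"
    using continuous_on_polymonial_function[OF p]
    by (intro compact_imp_bounded compact_continuous_image) auto
  then obtain B where B: "\<And>\<xi>. \<xi> \<in> {-r..r} \<Longrightarrow> norm (p \<xi>) \<le> B"
    unfolding bounded_iff by fastforce
  let ?S = "{s..T} \<times> cball (0 :: real ^ 'n) (r + \<bar>T\<bar> * \<bar>B\<bar>) \<times> {-r..r}"
  have sub: "{w. ?\<phi> w \<noteq> 0} \<subseteq> ?S"
  proof
    fix w :: "real \<times> (real ^ 'n) \<times> real"
    assume "w \<in> {w. ?\<phi> w \<noteq> 0}"
    moreover obtain t x \<xi> where w: "w = (t, x, \<xi>)" by (cases w)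
    ultimately have "E t \<noteq> 0" "R (x - t *\<^sub>R p \<xi>, \<xi>) \<noteq> 0" by auto
    then have t: "t \<in> {s..T}" and y: "norm (x - t *\<^sub>R p \<xi>, \<xi>) \<le> r"
      using E(3) R(2) by (blast, meson not_le_imp_less)
    have \<xi>: "\<bar>\<xi>\<bar> \<le> r" using order_trans[OF norm_snd_le y] by simp
    have x: "norm (x - t *\<^sub>R p \<xi>) \<le> r" by (rule order_trans[OF norm_fst_le y])
    have "norm (p \<xi>) \<le> B" using \<xi> by (intro B) (simp add: abs_le_iff)
    then have "norm (t *\<^sub>R p \<xi>) \<le> \<bar>T\<bar> * \<bar>B\<bar>"
      unfolding norm_scaleR using t E(2) by (intro mult_mono) auto
    then have "norm x \<le> r + \<bar>T\<bar> * \<bar>B\<bar>"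
      using x norm_triangle_sub[of x "t *\<^sub>R p \<xi>"] by linarith
    then show "w \<in> ?S" using t \<xi> w by auto
  qed
  have comp: "compact ?S" by (intro compact_Times compact_cball compact_Icc)
  show "compact (closure {w. ?\<phi> w \<noteq> 0})"
    using bounded_subset[OF compact_imp_bounded[OF comp] sub] by simp
  have "closure {w. ?\<phi> w \<noteq> 0} \<subseteq> ?S"
    by (rule closure_minimal[OF sub compact_imp_closed[OF comp]])
  also have "\<dots> \<subseteq> {0<..} \<times> UNIV" using E(2) by auto
  finally show "closure {w. ?\<phi> w \<noteq> 0} \<subseteq> {0<..} \<times> UNIV" .
qed

text \<open>The time derivative of the moving argument contributes -p and the transport term
  contributes a, so \<open>R\<close> is differentiated only along the mismatch a - p.\<close>

lemma kinetic_derivative_along_curves: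
  fixes p a :: "real \<Rightarrow> real ^ 'n::finite" and R :: "(real ^ 'n) \<times> real \<Rightarrow> real"
  assumes E: "\<And>t. (E has_real_derivative E' t) (at t)"
    and p: "polynomial_function p"
    and R: "\<And>z. (R has_derivative R' z) (at z)"
    and \<phi>: "\<phi> = (\<lambda>w. E (fst w) * R (fst (snd w) - fst w *\<^sub>R p (snd (snd w)), snd (snd w)))"
  shows "d_t \<phi> (t, x, \<xi>) + (\<Sum>i\<in>UNIV. a \<xi> $ i * d_x i \<phi> (t, x, \<xi>)) =
    E' t * R (x - t *\<^sub>R p \<xi>, \<xi>) + E t * R' (x - t *\<^sub>R p \<xi>, \<xi>) (a \<xi> - p \<xi>, 0)"
proof -
  let ?y = "(x - t *\<^sub>R p \<xi>, \<xi>)"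
  interpret R': linear "R' ?y" by (rule has_derivative_linear[OF R])
  obtain p' where "(p has_vector_derivative p' \<xi>) (at \<xi>)"
    using has_vector_derivative_polynomial_function[OF p] by metis
  then have p': "(p has_derivative (\<lambda>h. h *\<^sub>R p' \<xi>)) (at \<xi>)"
    by (simp add: has_vector_derivative_def)
  have "((\<lambda>w::real \<times> (real ^ 'n) \<times> real. snd (snd w)) has_derivative (\<lambda>v. snd (snd v))) (at (t, x, \<xi>))"
    by (intro has_derivative_snd has_derivative_ident)
  then have pY: "((\<lambda>w::real \<times> (real ^ 'n) \<times> real. p (snd (snd w))) has_derivative (\<lambda>v. snd (snd v) *\<^sub>R p' \<xi>)) (at (t, x, \<xi>))"
    by (rule has_derivative_compose) (use p' in simp)
  have Y: "((\<lambda>w. (fst (snd w) - fst w *\<^sub>R p (snd (snd w)), snd (snd w))) has_derivative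
      (\<lambda>v. (fst (snd v) - (t *\<^sub>R snd (snd v) *\<^sub>R p' \<xi> + fst v *\<^sub>R p \<xi>), snd (snd v)))) (at (t, x, \<xi>))"
    by (rule derivative_eq_intros refl pY | simp)+
  have E1: "((\<lambda>w::real \<times> (real ^ 'n) \<times> real. E (fst w)) has_derivative (\<lambda>v. fst v * E' t)) (at (t, x, \<xi>))"
    unfolding mult.commute[of _ "E' t"]
    by (rule has_derivative_compose[OF has_derivative_fst[OF has_derivative_ident]])
      (use E[of t] in \<open>simp add: has_field_derivative_def\<close>)
  have RY: "((\<lambda>w. R (fst (snd w) - fst w *\<^sub>R p (snd (snd w)), snd (snd w))) has_derivative
      (\<lambda>v. R' ?y (fst (snd v) - (t *\<^sub>R snd (snd v) *\<^sub>R p' \<xi> + fst v *\<^sub>R p \<xi>), snd (snd v)))) (at (t, x, \<xi>))"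
    using has_derivative_compose[OF Y, of R "R' ?y"] R by simp
  \<comment> \<open>The derivative of \<open>p\<close> is multiplied by the \<xi>-component of the
    direction, which is 0 in both \<open>d_t\<close> and \<open>d_x\<close>.\<close>
  have "frechet_derivative \<phi> (at (t, x, \<xi>)) = (\<lambda>v. E t * R' ?y (fst (snd v) - (t *\<^sub>R snd (snd v) *\<^sub>R p' \<xi> + fst v *\<^sub>R p \<xi>), snd (snd v))
      + fst v * E' t * R ?y)"
    using frechet_derivative_at[OF has_derivative_mult[OF E1 RY]] unfolding \<phi> by simp
  then have "d_t \<phi> (t, x, \<xi>) = E t * R' ?y (- p \<xi>, 0) + E' t * R ?y"
    and dx: "d_x i \<phi> (t, x, \<xi>) = E t * R' ?y (axis i 1, 0)" for i
    by (simp_all add: d_t_def d_x_def)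
  moreover have "(\<Sum>i\<in>UNIV. a \<xi> $ i * d_x i \<phi> (t, x, \<xi>)) = E t * R' ?y (a \<xi>, 0)"
  proof -
    have "(\<Sum>i\<in>UNIV. a \<xi> $ i *\<^sub>R (axis i 1 :: real ^ 'n, 0 :: real)) = (a \<xi>, 0)"
      using basis_expansion[of "a \<xi>"]
      by (simp add: prod_eq_iff fst_sum snd_sum scalar_mult_eq_scaleR)
    moreover have "R' ?y (\<Sum>i\<in>UNIV. a \<xi> $ i *\<^sub>R (axis i 1 :: real ^ 'n, 0 :: real))
        = (\<Sum>i\<in>UNIV. a \<xi> $ i * R' ?y (axis i 1, 0))"
      by (simp only: R'.sum R'.scale real_scaleR_def)
    ultimately have "R' ?y (a \<xi>, 0) = (\<Sum>i\<in>UNIV. a \<xi> $ i * R' ?y (axis i 1, 0))"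
      by simp
    then show ?thesis by (simp add: dx sum_distrib_left mult_ac)
  qed
  moreover have "R' ?y (a \<xi> - p \<xi>, 0) = R' ?y (- p \<xi>, 0) + R' ?y (a \<xi>, 0)"
    by (simp add: R'.add[symmetric])
  ultimately show ?thesis by (simp add: algebra_simps)
qed

lemma norm_snd_gt: "r < \<bar>snd y\<bar> \<Longrightarrow> r < norm y" for y :: "'a::real_normed_vector \<times> real"
  using order_trans[OF norm_snd_le[of "snd y" "fst y"]] by force

text \<open>By linearity the value is a finite sum of coordinates of the direction times functions
  continuous in the point, which settles the case where both vary together.\<close>

lemma borel_measurable_directional_derivative:
  fixes R' :: "'a::euclidean_space \<Rightarrow> 'a \<Rightarrow> real" and Y V :: "'b::euclidean_space \<Rightarrow> 'a"
  assumes lin: "\<And>z. linear (R' z)" and cont: "\<And>v. continuous_on UNIV (\<lambda>z. R' z v)"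
    and Y: "Y \<in> borel_measurable borel" and V: "V \<in> borel_measurable borel"
  shows "(\<lambda>z. R' (Y z) (V z)) \<in> borel_measurable borel"
proof -
  have "R' (Y z) (V z) = (\<Sum>j\<in>Basis. (V z \<bullet> j) * R' (Y z) j)" for z
  proof -
    interpret linear "R' (Y z)" by (rule lin)
    have "R' (Y z) (V z) = R' (Y z) (\<Sum>j\<in>Basis. (V z \<bullet> j) *\<^sub>R j)" by (simp add: euclidean_representation)
    then show ?thesis by (simp add: sum scale)
  qed
  moreover have "(\<lambda>z. R' (Y z) j) \<in> borel_measurable borel" for j
    using measurable_compose[OF Y borel_measurable_continuous_onI[OF cont[of j]]] .
  ultimately show ?thesis using V by simp
qed

text \<open>Since \<open>y\<close> keeps \<xi>, the argument lies outside the ball of radius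
  \<open>r\<close> as soon as \<xi> leaves the interval, and there the derivative vanishes. Inside,
  both velocities are at most C, hence the factor 2.\<close>

lemma velocity_error_bound:
  fixes a p :: "real \<Rightarrow> 'a::euclidean_space" and R' :: "'a \<times> real \<Rightarrow> 'a \<times> real \<Rightarrow> real"
    and y :: "'a \<times> real \<Rightarrow> 'a \<times> real"
  assumes R': "\<And>z v. r < norm z \<Longrightarrow> R' z v = 0"
    and K: "0 \<le> K" "\<And>z v. \<bar>R' z v\<bar> \<le> K * norm v"
    and C0: "0 \<le> C"
    and C: "\<And>\<xi>. \<xi> \<in> {-r..r} \<Longrightarrow> norm (p \<xi>) \<le> C"
      "AE \<xi> in lborel. \<xi> \<in> {-r..r} \<longrightarrow> norm (a \<xi>) \<le> C"
    and y: "\<And>z. snd (y z) = snd z"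
  shows "AE z in lborel. \<bar>R' (y z) (a (snd z) - p (snd z), 0)\<bar> \<le> K * (2 * C)"
  using AE_snd_lborel[OF C(2), where 'a = 'a]
proof eventually_elim
  case (elim z)
  show ?case
  proof (cases "\<bar>snd z\<bar> \<le> r")
    case True
    then have "norm (a (snd z) - p (snd z), 0::real) \<le> 2 * C"
      using elim C(1)[of "snd z"] norm_triangle_ineq4[of "a (snd z)" "p (snd z)"]
      by (auto simp: norm_Pair abs_le_iff)
    then show ?thesis using K(1) by (intro order_trans[OF K(2)] mult_left_mono)
  next
    case False
    then have "r < norm (y z)" by (intro norm_snd_gt) (simp add: y)
    then show ?thesis using K(1) C0 by (simp add: R')
  qed
qed

text \<open>The test function is E(t) R(x - t p(\<xi>), \<xi>) with E = e^(lam t) \<theta>. When the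
  two equations are subtracted, the part lam E of E' cancels the source; what remains is \<theta>'
  times the pairing and \<theta> times the velocity error.\<close>

lemma kinetic_weak_identity:
  fixes a p :: "real \<Rightarrow> real ^ 'n::finite" and R :: "(real ^ 'n) \<times> real \<Rightarrow> real"
    and f M :: "real \<Rightarrow> (real ^ 'n) \<times> real \<Rightarrow> real"
  assumes a: "Linf_loc a" and f: "cont_L1 {0..} f" and M: "cont_L1 {0..} M"
    and f_eq: "kinetic_eq a f (\<lambda>t z. lam * (M t z - f t z))"
    and M_eq: "kinetic_eq a M (\<lambda>t z. 0)"
    and R: "\<And>k. C_k k R" "\<And>z. r < norm z \<Longrightarrow> R z = 0"
    and R': "\<And>z. (R has_derivative R' z) (at z)" "\<And>v. continuous_on UNIV (\<lambda>z. R' z v)"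
      "\<And>z v. r < norm z \<Longrightarrow> R' z v = 0"
    and K: "0 \<le> K" "\<And>z. \<bar>R z\<bar> \<le> K" "\<And>z v. \<bar>R' z v\<bar> \<le> K * norm v"
    and p: "polynomial_function p"
    and C0: "0 \<le> C"
    and C: "\<And>\<xi>. \<xi> \<in> {-r..r} \<Longrightarrow> norm (p \<xi>) \<le> C"
      "AE \<xi> in lborel. \<xi> \<in> {-r..r} \<longrightarrow> norm (a \<xi>) \<le> C"
    and \<theta>: "\<And>k. C_k k \<theta>" "0 < s" "\<And>t. t \<notin> {s..T} \<Longrightarrow> \<theta> t = 0"
      "\<And>t. (\<theta> has_real_derivative \<theta>' t) (at t)" "continuous_on UNIV \<theta>'"
  defines "y \<equiv> \<lambda>t z. (fst z - t *\<^sub>R p (snd z), snd z)"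
  defines "G \<equiv> \<lambda>t. exp (lam * t) * (\<theta>' t * (\<integral>z. (f t z - M t z) * R (y t z) \<partial>lborel)
      + \<theta> t * (\<integral>z. (f t z - M t z) * R' (y t z) (a (snd z) - p (snd z), 0) \<partial>lborel))"
  shows "continuous_on {0..} G" and "(LINT t:{0<..}|lborel. G t) = 0"
proof -
  define E where "E t = exp (lam * t) * \<theta> t" for t
  define E' where "E' t = exp (lam * t) * (lam * \<theta> t + \<theta>' t)" for t
  define q where "q t z = R' (y t z) (a (snd z) - p (snd z), 0)" for t z
  \<comment> \<open>At each fixed time, \<open>k0\<close> is the test function and \<open>k1\<close>
    the transport operator applied to it.\<close>
  define k0 where "k0 t z = E t * R (y t z)" for t z
  define k1 where "k1 t z = E' t * R (y t z) + E t * q t z" for t z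
  have E_smooth: "C_k k E" for k
    unfolding E_def[abs_def]
    by (intro C_k_mult \<theta>(1) C_k_compose_real[OF C_k_exp] C_k_const C_k_linear bounded_linear_mult_right)
  have E_der: "(E has_real_derivative E' t) (at t)" for t
    unfolding E_def[abs_def] E'_def
    by (auto intro!: derivative_eq_intros \<theta>(4) simp: algebra_simps)
  have \<theta>'_0: "\<theta>' t = 0" if "t \<notin> {s..T}" for t
    by (rule DERIV_zero_outside[OF \<theta>(4) \<theta>(3) that])
  have E_0: "E t = 0" "E' t = 0" if "t \<notin> {s..T}" for t
    using that \<theta>(3) \<theta>'_0 by (simp_all add: E_def E'_def)
  have E_cont: "continuous_on UNIV E" "continuous_on UNIV E'"
    unfolding E_def[abs_def] E'_def[abs_def]
    by (intro continuous_intros \<theta>(5) C_k_imp_continuous[OF \<theta>(1)])+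
  obtain B where B: "\<And>t. \<bar>E t\<bar> \<le> B" "0 \<le> B"
    using continuous_compact_support_bounded[OF E_cont(1) compact_Icc E_0(1)] by blast
  obtain B' where B': "\<And>t. \<bar>E' t\<bar> \<le> B'" "0 \<le> B'"
    using continuous_compact_support_bounded[OF E_cont(2) compact_Icc E_0(2)] by blast
  have p_cont: "continuous_on UNIV p" by (rule continuous_on_polymonial_function[OF p])
  have y_cont_t: "continuous_on UNIV (\<lambda>t. y t z)" for z
    unfolding y_def by (intro continuous_intros)
  have [measurable]: "p \<in> borel_measurable borel" by (rule borel_measurable_continuous_onI[OF p_cont])
  have [measurable]: "a \<in> borel_measurable borel" using a by (simp add: Linf_loc_def)
  have y_meas: "y t \<in> borel_measurable borel" for t
    unfolding y_def
    by (intro borel_measurable_continuous_onI continuous_intros continuous_on_compose2[OF p_cont]) auto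
  have R_lin: "linear (R' z)" for z by (rule has_derivative_linear[OF R'(1)])
  have R_cont: "continuous_on UNIV R" by (rule C_k_imp_continuous[OF R(1)])
  have Ry_meas: "(\<lambda>z. R (y t z)) \<in> borel_measurable borel" for t
    by (rule measurable_compose[OF y_meas borel_measurable_continuous_onI[OF R_cont]])
  have av_meas: "(\<lambda>z::(real ^ 'n) \<times> real. (a (snd z) - p (snd z), 0::real)) \<in> borel_measurable borel"
    unfolding borel_prod[symmetric] by measurable
  have q_meas: "q t \<in> borel_measurable borel" for t
    unfolding q_def by (rule borel_measurable_directional_derivative[OF R_lin R'(2) y_meas av_meas])
  have q_bound: "AE z in lborel. \<bar>q t z\<bar> \<le> K * (2 * C)" for t
    unfolding q_def by (rule velocity_error_bound[OF R'(3) K(1,3) C0 C]) (simp_all add: y_def)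
  have E_sub: "continuous_on {0..} E" "continuous_on {0..} E'"
    by (rule continuous_on_subset[OF E_cont(1)] continuous_on_subset[OF E_cont(2)], simp)+
  have y_sub: "continuous_on {0..} (\<lambda>t. y t z)" for z
    by (rule continuous_on_subset[OF y_cont_t]) simp
  have Ry_cont: "continuous_on {0..} (\<lambda>t. R (y t z))" for z
    by (rule continuous_on_compose2[OF R_cont y_sub]) simp
  have q_cont: "continuous_on {0..} (\<lambda>t. q t z)" for z
    unfolding q_def by (rule continuous_on_compose2[OF R'(2) y_sub]) simp
  have k0_ass: "k0 t \<in> borel_measurable borel" "AE z in lborel. \<bar>k0 t z\<bar> \<le> B * K"
    "continuous_on {0..} (\<lambda>t. k0 t z)" for t z
  proof -
    show "k0 t \<in> borel_measurable borel" unfolding k0_def using Ry_meas by measurable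
    show "AE z in lborel. \<bar>k0 t z\<bar> \<le> B * K"
      unfolding k0_def abs_mult by (intro AE_I2 mult_mono B K) auto
    show "continuous_on {0..} (\<lambda>t. k0 t z)"
      unfolding k0_def
      by (rule continuous_on_mult[OF E_sub(1) Ry_cont])
  qed
  have k1_ass: "k1 t \<in> borel_measurable borel" "AE z in lborel. \<bar>k1 t z\<bar> \<le> B' * K + B * (K * (2 * C))"
    "continuous_on {0..} (\<lambda>t. k1 t z)" for t z
  proof -
    show "k1 t \<in> borel_measurable borel" unfolding k1_def using Ry_meas q_meas by measurable
    show "AE z in lborel. \<bar>k1 t z\<bar> \<le> B' * K + B * (K * (2 * C))"
      using q_bound[of t]
    proof eventually_elim
      case (elim z)
      have "\<bar>E' t * R (y t z)\<bar> \<le> B' * K" unfolding abs_mult by (intro mult_mono B' K) auto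
      moreover have "\<bar>E t * q t z\<bar> \<le> B * (K * (2 * C))"
        unfolding abs_mult by (intro mult_mono B elim) auto
      ultimately show ?case unfolding k1_def by linarith
    qed
    show "continuous_on {0..} (\<lambda>t. k1 t z)"
      unfolding k1_def
      by (rule continuous_on_add[OF continuous_on_mult[OF E_sub(2) Ry_cont] continuous_on_mult[OF E_sub(1) q_cont]])
  qed
  define g where "g = (\<lambda>t z. f t z - M t z)"
  have g: "cont_L1 {0..} g" unfolding g_def by (rule cont_L1_diff[OF f M])
  have int: "integrable lborel (f t)" "integrable lborel (M t)" "integrable lborel (g t)" if "t \<in> {0..}" for t
    using f M g that by (auto simp: cont_L1_def)
  have F_cont: "continuous_on {0..} (\<lambda>t. \<integral>z. f t z * k1 t z \<partial>lborel)"
      "continuous_on {0..} (\<lambda>t. \<integral>z. M t z * k1 t z \<partial>lborel)"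
      "continuous_on {0..} (\<lambda>t. \<integral>z. g t z * k0 t z \<partial>lborel)"
    by (rule pairing_continuous[OF _ k1_ass] pairing_continuous[OF _ k0_ass], fact)+
  have k_0: "k0 t = (\<lambda>z. 0)" "k1 t = (\<lambda>z. 0)" if "t \<notin> {s..T}" for t
    using E_0[OF that] by (simp_all add: k0_def k1_def fun_eq_iff)
  \<comment> \<open>Splitting the time integral of a difference needs integrable parts; continuity
    in time and support in a compact interval of positive times supply this.\<close>
  have F_int: "set_integrable lborel {0<..} (\<lambda>t. \<integral>z. f t z * k1 t z \<partial>lborel)"
      "set_integrable lborel {0<..} (\<lambda>t. \<integral>z. M t z * k1 t z \<partial>lborel)"
      "set_integrable lborel {0<..} (\<lambda>t. \<integral>z. g t z * k0 t z \<partial>lborel)"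
    by (rule set_integrable_Ioi[OF F_cont(1) \<theta>(2), of T] set_integrable_Ioi[OF F_cont(2) \<theta>(2), of T]
        set_integrable_Ioi[OF F_cont(3) \<theta>(2), of T], simp add: k_0)+
  have G_eq: "G t = (\<integral>z. f t z * k1 t z \<partial>lborel) - (\<integral>z. M t z * k1 t z \<partial>lborel) - lam * (\<integral>z. g t z * k0 t z \<partial>lborel)"
    if t: "t \<in> {0..}" for t
  proof -
    note intb = integrable_mult_bounded(1)
    have i1: "integrable lborel (\<lambda>z. g t z * R (y t z))"
      by (rule intb[OF int(3)[OF t] Ry_meas, of _ K]) (simp add: K)
    have i2: "integrable lborel (\<lambda>z. g t z * q t z)"
      by (rule intb[OF int(3)[OF t] q_meas q_bound])
    have "(\<integral>z. f t z * k1 t z \<partial>lborel) - (\<integral>z. M t z * k1 t z \<partial>lborel) = (\<integral>z. g t z * k1 t z \<partial>lborel)"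
      unfolding g_def left_diff_distrib
      by (rule Bochner_Integration.integral_diff[OF intb[OF int(1)[OF t] k1_ass(1,2)]
          intb[OF int(2)[OF t] k1_ass(1,2)], symmetric])
    also have "\<dots> = (\<integral>z. E' t * (g t z * R (y t z)) + E t * (g t z * q t z) \<partial>lborel)"
      by (simp add: k1_def algebra_simps)
    also have "\<dots> = E' t * (\<integral>z. g t z * R (y t z) \<partial>lborel) + E t * (\<integral>z. g t z * q t z \<partial>lborel)"
      using i1 i2 by simp
    moreover have "(\<integral>z. g t z * k0 t z \<partial>lborel) = E t * (\<integral>z. g t z * R (y t z) \<partial>lborel)"
      by (simp add: k0_def mult.left_commute)
    ultimately show ?thesis
      unfolding G_def E_def E'_def by (simp add: g_def q_def algebra_simps)
  qed
  show "continuous_on {0..} G"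
  proof (rule continuous_on_eq)
    show "continuous_on {0..} (\<lambda>t. (\<integral>z. f t z * k1 t z \<partial>lborel) - (\<integral>z. M t z * k1 t z \<partial>lborel)
        - lam * (\<integral>z. g t z * k0 t z \<partial>lborel))"
      by (intro continuous_on_diff continuous_on_mult continuous_on_const F_cont)
  qed (simp add: G_eq)
  define \<phi> where "\<phi> = (\<lambda>w. E (fst w) * R (fst (snd w) - fst w *\<^sub>R p (snd (snd w)), snd (snd w)))"
  have test: "test_function ({0<..} \<times> UNIV) \<phi>"
    unfolding \<phi>_def by (rule test_function_along_curves[OF E_smooth \<theta>(2) E_0(1) p R])
  have k1_eq: "d_t \<phi> (t, x, \<xi>) + (\<Sum>i\<in>UNIV. a \<xi> $ i * d_x i \<phi> (t, x, \<xi>)) = k1 t (x, \<xi>)" for t x \<xi>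
    unfolding kinetic_derivative_along_curves[OF E_der p R'(1) \<phi>_def] by (simp add: k1_def q_def y_def)
  have k0_eq: "\<phi> (t, x, \<xi>) = k0 t (x, \<xi>)" for t x \<xi> by (simp add: k0_def \<phi>_def y_def)
  have pair: "- (LINT t:{0<..}|lborel. \<integral>z. h t z * k1 t z \<partial>lborel)
      = (LINT t:{0<..}|lborel. \<integral>z. S t z * k0 t z \<partial>lborel)" if "kinetic_eq a h S" for h S
  proof -
    have "- (LINT t:{0<..}|lborel. LINT (x, \<xi>)|lborel.
          h t (x, \<xi>) * (d_t \<phi> (t, x, \<xi>) + (\<Sum>i\<in>UNIV. a \<xi> $ i * d_x i \<phi> (t, x, \<xi>))))
        = (LINT t:{0<..}|lborel. LINT (x, \<xi>)|lborel. S t (x, \<xi>) * \<phi> (t, x, \<xi>))"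
      using that test unfolding kinetic_eq_def by blast
    then show ?thesis unfolding k1_eq k0_eq by (simp add: split_beta')
  qed
  have "- (LINT t:{0<..}|lborel. \<integral>z. f t z * k1 t z \<partial>lborel)
      = (LINT t:{0<..}|lborel. \<integral>z. lam * (M t z - f t z) * k0 t z \<partial>lborel)"
    by (rule pair[OF f_eq])
  also have "\<dots> = (LINT t:{0<..}|lborel. - lam * (\<integral>z. g t z * k0 t z \<partial>lborel))"
  proof -
    \<comment> \<open>This holds for every real \<open>t\<close>, also where nothing is known about
      f and M, because constants leave a Bochner integral unconditionally.\<close>
    have "(\<integral>z. lam * (M t z - f t z) * k0 t z \<partial>lborel) = - lam * (\<integral>z. g t z * k0 t z \<partial>lborel)" for t
      by (subst integral_mult_right_zero[symmetric]) (simp add: g_def algebra_simps)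
    then show ?thesis by simp
  qed
  also have "\<dots> = - lam * (LINT t:{0<..}|lborel. \<integral>z. g t z * k0 t z \<partial>lborel)"
    by (rule set_integral_mult_right)
  finally have f': "(LINT t:{0<..}|lborel. \<integral>z. f t z * k1 t z \<partial>lborel)
      = lam * (LINT t:{0<..}|lborel. \<integral>z. g t z * k0 t z \<partial>lborel)" by simp
  have M': "(LINT t:{0<..}|lborel. \<integral>z. M t z * k1 t z \<partial>lborel) = 0"
    using pair[OF M_eq] by (simp add: set_lebesgue_integral_def)
  have "(LINT t:{0<..}|lborel. G t) = (LINT t:{0<..}|lborel. (\<integral>z. f t z * k1 t z \<partial>lborel)
      - (\<integral>z. M t z * k1 t z \<partial>lborel) - lam * (\<integral>z. g t z * k0 t z \<partial>lborel))"
    by (rule set_lebesgue_integral_cong) (auto simp: G_eq)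
  also have "\<dots> = 0"
    using F_int f' M' by (simp add: set_integral_diff)
  finally show "(LINT t:{0<..}|lborel. G t) = 0" .
qed

subsection \<open>Transport along the characteristics\<close>

text \<open>Let c be the left-hand side as a function of time. For fixed \<theta> the weak identity
  passes to the limit along the polynomials, first in the pairings at each time and then in the time
  integral, and says that the integral of \<theta>' c vanishes. Hence c is constant for t > 0, and
  continuity reaches t = 0.\<close>

lemma pairing_along_characteristics:
  fixes a :: "real \<Rightarrow> real ^ 'n::finite" and R :: "(real ^ 'n) \<times> real \<Rightarrow> real"
    and f M :: "real \<Rightarrow> (real ^ 'n) \<times> real \<Rightarrow> real"
  assumes a: "Linf_loc a" and f: "cont_L1 {0..} f" and M: "cont_L1 {0..} M"
    and f_eq: "kinetic_eq a f (\<lambda>t z. lam * (M t z - f t z))"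
    and M_eq: "kinetic_eq a M (\<lambda>t z. 0)"
    and R: "\<And>k. C_k k R" "\<And>z. r < norm z \<Longrightarrow> R z = 0"
    and t: "0 \<le> t"
  shows "exp (lam * t) * (\<integral>z. (f t z - M t z) * R (fst z - t *\<^sub>R a (snd z), snd z) \<partial>lborel)
    = (\<integral>z. (f 0 z - M 0 z) * R z \<partial>lborel)"
proof -
  obtain K R' where K: "0 \<le> K" "\<And>z. \<bar>R z\<bar> \<le> K" and R': "\<And>z. (R has_derivative R' z) (at z)"
    "\<And>v. continuous_on UNIV (\<lambda>z. R' z v)" and KR': "\<And>z v. \<bar>R' z v\<bar> \<le> K * norm v"
    and R'_0: "\<And>z v. r < norm z \<Longrightarrow> R' z v = 0"
    by (rule C_k_compact_support_bounds[where r = r, OF R], assumption, rule that)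
  obtain p C where p: "\<And>n. polynomial_function (p n)" and C0: "0 \<le> C"
    and pC: "\<And>n \<xi>. \<xi> \<in> {-r..r} \<Longrightarrow> norm (p n \<xi>) \<le> C"
    and aC: "AE \<xi> in lborel. \<xi> \<in> {-r..r} \<longrightarrow> norm (a \<xi>) \<le> C"
    and lim: "AE \<xi> in lborel. \<xi> \<in> {-r..r} \<longrightarrow> (\<lambda>n::nat. p n \<xi>) \<longlonglongrightarrow> a \<xi>"
    by (rule polynomial_approximation_AE[OF a, of r]) (rule that)
  define g where "g = (\<lambda>t z. f t z - M t z)"
  have g: "cont_L1 {0..} g" unfolding g_def by (rule cont_L1_diff[OF f M])
  have g_int: "integrable lborel (g t)" if "0 \<le> t" for t
    using g that by (auto simp: cont_L1_def)
  define y where "y t z = (fst z - t *\<^sub>R a (snd z), snd z)" for t and z :: "(real ^ 'n) \<times> real"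
  define yn where "yn n t z = (fst z - t *\<^sub>R p n (snd z), snd z)" for n t and z :: "(real ^ 'n) \<times> real"
  define q where "q n t z = R' (yn n t z) (a (snd z) - p n (snd z), 0)" for n t z
  define P where "P t = (\<integral>z. g t z * R (y t z) \<partial>lborel)" for t
  define Pn where "Pn n t = (\<integral>z. g t z * R (yn n t z) \<partial>lborel)" for n t
  define Qn where "Qn n t = (\<integral>z. g t z * q n t z \<partial>lborel)" for n t
  define c where "c t = exp (lam * t) * P t" for t
  have [measurable]: "a \<in> borel_measurable borel" using a by (simp add: Linf_loc_def)
  have p_cont: "continuous_on UNIV (p n)" for n by (rule continuous_on_polymonial_function[OF p])
  have [measurable]: "p n \<in> borel_measurable borel" for n by (rule borel_measurable_continuous_onI[OF p_cont])
  have y_meas: "y t \<in> borel_measurable borel" and yn_meas: "yn n t \<in> borel_measurable borel" for n t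
    unfolding y_def yn_def borel_prod[symmetric] by measurable
  have av_meas: "(\<lambda>z::(real ^ 'n) \<times> real. (a (snd z) - p n (snd z), 0::real)) \<in> borel_measurable borel" for n
    unfolding borel_prod[symmetric] by measurable
  have R_lin: "linear (R' z)" for z by (rule has_derivative_linear[OF R'(1)])
  have R_cont: "continuous_on UNIV R" by (rule C_k_imp_continuous[OF R(1)])
  have R_at: "isCont R z" for z using R_cont continuous_on_eq_continuous_at[OF open_UNIV] by blast
  note R_meas = borel_measurable_continuous_onI[OF R_cont]
  have Ry_meas: "(\<lambda>z. R (y t z)) \<in> borel_measurable borel" "(\<lambda>z. R (yn n t z)) \<in> borel_measurable borel" for n t
    by (rule measurable_compose[OF y_meas R_meas] measurable_compose[OF yn_meas R_meas])+
  have q_meas: "q n t \<in> borel_measurable borel" for n t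
    unfolding q_def by (rule borel_measurable_directional_derivative[OF R_lin R'(2) yn_meas av_meas])
  have q_bound: "AE z in lborel. \<bar>q n t z\<bar> \<le> K * (2 * C)" for n t
    unfolding q_def by (rule velocity_error_bound[OF R'_0 K(1) KR' C0 pC aC]) (simp_all add: yn_def)
  have Pn_lim: "(\<lambda>n. Pn n t) \<longlonglongrightarrow> P t" if t: "0 \<le> t" for t
    unfolding Pn_def P_def
  proof (rule integral_dominated_convergence[where w = "\<lambda>z. \<bar>g t z\<bar> * K"])
    show "AE z in lborel. (\<lambda>n. g t z * R (yn n t z)) \<longlonglongrightarrow> g t z * R (y t z)"
      using AE_snd_lborel[OF lim, where 'a = "real ^ 'n"]
    proof eventually_elim
      case (elim z)
      have "(\<lambda>n. R (yn n t z)) \<longlonglongrightarrow> R (y t z)"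
      proof (cases "\<bar>snd z\<bar> \<le> r")
        case True
        with elim have "(\<lambda>n. p n (snd z)) \<longlonglongrightarrow> a (snd z)" by (auto simp: abs_le_iff)
        then have "(\<lambda>n. yn n t z) \<longlonglongrightarrow> y t z"
          unfolding yn_def y_def by (intro tendsto_intros)
        then show ?thesis by (rule isCont_tendsto_compose[OF R_at])
      next
        case False
        then have "r < norm (yn n t z)" "r < norm (y t z)" for n
          by (intro norm_snd_gt, simp add: yn_def y_def)+
        then show ?thesis by (simp add: R(2))
      qed
      then show ?case by (intro tendsto_mult tendsto_const)
    qed
    show "AE z in lborel. norm (g t z * R (yn n t z)) \<le> \<bar>g t z\<bar> * K" for n
      by (simp add: abs_mult mult_left_mono K)
  qed (use g_int[OF t] Ry_meas in \<open>auto intro!: borel_measurable_times\<close>)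
  \<comment> \<open>For \<xi> in the interval the integrand is at most K times |g| |a - p_n|, which
    tends to 0 almost everywhere; elsewhere \<open>R'\<close> vanishes.\<close>
  have Qn_lim: "(\<lambda>n. Qn n t) \<longlonglongrightarrow> 0" if t: "0 \<le> t" for t
  proof -
    have "(\<lambda>n. Qn n t) \<longlonglongrightarrow> (\<integral>z. 0 \<partial>(lborel :: ((real ^ 'n) \<times> real) measure))"
      unfolding Qn_def
    proof (rule integral_dominated_convergence[where w = "\<lambda>z. \<bar>g t z\<bar> * (K * (2 * C))"])
      show "AE z in lborel. (\<lambda>n. g t z * q n t z) \<longlonglongrightarrow> 0"
        using AE_snd_lborel[OF lim, where 'a = "real ^ 'n"]
      proof eventually_elim
        case (elim z)
        have "(\<lambda>n. q n t z) \<longlonglongrightarrow> 0"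
        proof (cases "\<bar>snd z\<bar> \<le> r")
          case True
          with elim have "(\<lambda>n. p n (snd z)) \<longlonglongrightarrow> a (snd z)" by (auto simp: abs_le_iff)
          then have "(\<lambda>n. K * norm (a (snd z) - p n (snd z), 0::real)) \<longlonglongrightarrow> K * norm (a (snd z) - a (snd z), 0::real)"
            by (intro tendsto_intros)
          then have *: "(\<lambda>n. K * norm (a (snd z) - p n (snd z), 0::real)) \<longlonglongrightarrow> 0"
            by (simp add: norm_Pair)
          show ?thesis
            by (rule Lim_null_comparison[OF _ *])
              (unfold q_def real_norm_def, intro always_eventually allI KR')
        next
          case False
          then have "r < norm (yn n t z)" for n
            by (intro norm_snd_gt) (simp add: yn_def)
          then show ?thesis by (simp add: q_def R'_0)
        qed
        from tendsto_mult[OF tendsto_const this, of "g t z"] show ?case by simp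
      qed
      show "AE z in lborel. norm (g t z * q n t z) \<le> \<bar>g t z\<bar> * (K * (2 * C))" for n
        using q_bound[of n t] by eventually_elim (simp add: abs_mult mult_left_mono)
    qed (use g_int[OF t] q_meas in \<open>auto intro!: borel_measurable_times\<close>)
    then show ?thesis by simp
  qed
  have P_cont: "continuous_on {0..} P"
    unfolding P_def[abs_def]
  proof (rule pairing_continuous[OF g, where C = K])
    show "continuous_on {0..} (\<lambda>t. R (y t z))" for z
      unfolding y_def by (intro continuous_on_compose2[OF R_cont] continuous_intros) auto
  qed (use Ry_meas K in auto)
  have c_cont: "continuous_on {0..} c"
    unfolding c_def[abs_def] by (intro continuous_on_mult P_cont continuous_intros)
  have const: "c s = c t" if st: "0 < s" "s < t" for s t
  proof (rule du_bois_reymond[OF _ _ st])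
    show "continuous_on {0<..} c" by (rule continuous_on_subset[OF c_cont]) auto
  next
    fix \<theta> \<theta>' :: "real \<Rightarrow> real" and s T :: real
    assume \<theta>: "\<And>k. C_k k \<theta>" "0 < s" "\<And>r. r \<notin> {s..T} \<Longrightarrow> \<theta> r = 0"
      "\<And>r. (\<theta> has_real_derivative \<theta>' r) (at r)" "continuous_on UNIV \<theta>'"
    define G where "G n t = exp (lam * t) * (\<theta>' t * Pn n t + \<theta> t * Qn n t)" for n t
    have G: "continuous_on {0..} (G n)" "(LINT t:{0<..}|lborel. G n t) = 0" for n
      using kinetic_weak_identity[OF a f M f_eq M_eq R R' R'_0 K KR' p C0 pC aC \<theta>]
      unfolding G_def[abs_def] Pn_def Qn_def yn_def q_def g_def by blast+
    have \<theta>'_0: "\<theta>' t = 0" if "t \<notin> {s..T}" for t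
    by (rule DERIV_zero_outside[OF \<theta>(4) \<theta>(3) that])
    obtain B where B: "\<And>t. \<bar>\<theta> t\<bar> \<le> B" "0 \<le> B"
      using continuous_compact_support_bounded[OF C_k_imp_continuous[OF \<theta>(1)] compact_Icc \<theta>(3)] by blast
    obtain B' where B': "\<And>t. \<bar>\<theta>' t\<bar> \<le> B'" "0 \<le> B'"
      using continuous_compact_support_bounded[OF \<theta>(5) compact_Icc \<theta>'_0] by blast
    obtain N where N: "\<And>t. t \<in> {s..T} \<Longrightarrow> L1_norm (g t) \<le> N"
      using cont_L1_norm_bounded[OF g, of s T] \<theta>(2) by auto
    \<comment> \<open>A bound for \<open>G n\<close> on the time interval from \<open>s\<close> to
      \<open>T\<close>, uniform in \<open>n\<close>: it collects the bounds for the exponential,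
      \<theta>, \<theta>', \<open>R\<close>, the velocity error and the norm of
      \<open>g\<close>.\<close>
    define W where "W = exp (\<bar>lam\<bar> * \<bar>T\<bar>) * (B' * (K * N) + B * (K * (2 * C) * N))"
    have G_bound: "\<bar>G n t\<bar> \<le> W" if t: "t \<in> {s..T}" for n t
    proof -
      have t0: "0 \<le> t" using t \<theta>(2) by auto
      have "\<bar>Pn n t\<bar> \<le> K * L1_norm (g t)"
        unfolding Pn_def by (rule integrable_mult_bounded(2)[OF g_int[OF t0] Ry_meas(2)]) (simp add: K)
      also have "\<dots> \<le> K * N" by (intro mult_left_mono N t K)
      finally have 1: "\<bar>\<theta>' t * Pn n t\<bar> \<le> B' * (K * N)"
        unfolding abs_mult by (intro mult_mono B') auto
      have "\<bar>Qn n t\<bar> \<le> K * (2 * C) * L1_norm (g t)"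
        unfolding Qn_def by (rule integrable_mult_bounded(2)[OF g_int[OF t0] q_meas q_bound])
      also have "\<dots> \<le> K * (2 * C) * N" using K C0 by (intro mult_left_mono N t) auto
      finally have 2: "\<bar>\<theta> t * Qn n t\<bar> \<le> B * (K * (2 * C) * N)"
        unfolding abs_mult by (intro mult_mono B) auto
      have "lam * t \<le> \<bar>lam\<bar> * t" using t0 by (intro mult_right_mono) auto
      also have "\<dots> \<le> \<bar>lam\<bar> * \<bar>T\<bar>" using t by (intro mult_left_mono) auto
      finally have 3: "exp (lam * t) \<le> exp (\<bar>lam\<bar> * \<bar>T\<bar>)" by simp
      show ?thesis
        unfolding G_def W_def abs_mult using 1 2 3 by (intro mult_mono) auto
    qed
    have G_0: "G n t = 0" if "t \<notin> {s..T}" for n t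
      using \<theta>'_0[OF that] \<theta>(3)[OF that] by (simp add: G_def)
    have "(\<lambda>n. LINT t:{0<..}|lborel. G n t) \<longlonglongrightarrow> (LINT t:{0<..}|lborel. \<theta>' t * c t)"
      unfolding set_lebesgue_integral_def
    proof (rule integral_dominated_convergence[where w = "\<lambda>t. W * indicator {s..T} t"])
      show "(\<lambda>t. indicator {0<..} t *\<^sub>R (\<theta>' t * c t)) \<in> borel_measurable lborel"
        unfolding measurable_lborel2
        by (rule borel_measurable_continuous_on_indicator[OF _ continuous_on_mult[OF
              continuous_on_subset[OF \<theta>(5)] continuous_on_subset[OF c_cont]]]) auto
      show "(\<lambda>t. indicator {0<..} t *\<^sub>R G n t) \<in> borel_measurable lborel" for n
        unfolding measurable_lborel2
        by (rule borel_measurable_continuous_on_indicator[OF _ continuous_on_subset[OF G(1)]]) auto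
      show "integrable lborel (\<lambda>t. W * indicator {s..T} t)"
        using emeasure_bounded_finite[of "{s..T}"]
        by (intro integrable_mult_right integrable_real_indicator) auto
      have "(\<lambda>n. G n t) \<longlonglongrightarrow> \<theta>' t * c t" if t: "0 < t" for t
      proof -
        have "(\<lambda>n. G n t) \<longlonglongrightarrow> exp (lam * t) * (\<theta>' t * P t + \<theta> t * 0)"
          unfolding G_def using t by (intro tendsto_intros Pn_lim Qn_lim) auto
        then show ?thesis by (simp add: c_def mult.left_commute)
      qed
      then show "AE t in lborel. (\<lambda>n. indicator {0<..} t *\<^sub>R G n t) \<longlonglongrightarrow> indicator {0<..} t *\<^sub>R (\<theta>' t * c t)"
        by (intro AE_I2) (auto simp: indicator_def)
      show "AE t in lborel. norm (indicator {0<..} t *\<^sub>R G n t) \<le> W * indicator {s..T} t" for n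
      proof (intro AE_I2)
        fix t show "norm (indicator {0<..} t *\<^sub>R G n t) \<le> W * indicator {s..T} t"
          using G_bound[of t n] G_0[of t n] \<theta>(2) by (cases "t \<in> {s..T}") (auto simp: indicator_def)
      qed
    qed
    then show "(LINT t:{0<..}|lborel. \<theta>' t * c t) = 0"
      unfolding G(2) by (simp add: LIMSEQ_const_iff)
  qed
  \<comment> \<open>Test functions are supported in t > 0, so the initial value is reached only
    through the continuity of \<open>c\<close>, along the points t/(n + 1).\<close>
  have "c t = c 0"
  proof (cases "t = 0")
    case False
    then have t: "0 < t" using t by simp
    have "(\<lambda>n. t * inverse (real (Suc n))) \<longlonglongrightarrow> t * 0"
      by (intro tendsto_mult tendsto_const LIMSEQ_inverse_real_of_nat)
    then have s: "(\<lambda>n. t * inverse (real (Suc n))) \<longlonglongrightarrow> 0" by simp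
    have "(\<lambda>n. c (t * inverse (real (Suc n)))) \<longlonglongrightarrow> c 0"
      by (rule continuous_on_tendsto_compose[OF c_cont s]) (use t in auto)
    \<comment> \<open>For n = 0 the point is \<open>t\<close> itself, which the strict inequality in
      \<open>const\<close> excludes.\<close>
    moreover have "c (t * inverse (real (Suc n))) = c t" for n
    proof (cases "n = 0")
      case False
      then show ?thesis using t by (intro const) (auto simp: field_simps)
    qed simp
    ultimately show ?thesis by (simp add: LIMSEQ_const_iff)
  qed simp
  then show ?thesis by (simp add: c_def P_def g_def y_def)
qed

section \<open>From smooth functions to Borel sets\<close>

text \<open>As functions of \<open>A\<close>, the two sides are finite signed measures: the image
  under \<Phi> of the density \<open>h1\<close>, and the density \<open>h0\<close>. They agree on
  boxes, an intersection-stable generator, so a Dynkin class argument applies; it is run on the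
  integrals because the densities may change sign.\<close>

lemma borel_pairing_eqI:
  fixes h1 h0 :: "'a::euclidean_space \<Rightarrow> real"
  assumes int: "integrable lborel h1" "integrable lborel h0"
    and \<Phi>: "\<Phi> \<in> borel_measurable borel"
    and box: "\<And>l u. (\<integral>z. h1 z * indicator (box l u) (\<Phi> z) \<partial>lborel) = (\<integral>z. h0 z * indicator (box l u) z \<partial>lborel)"
    and A: "A \<in> sets borel"
  shows "(\<integral>z. h1 z * indicator A (\<Phi> z) \<partial>lborel) = (\<integral>z. h0 z * indicator A z \<partial>lborel)"
proof -
  have \<Phi>': "(\<lambda>z. indicator A (\<Phi> z) :: real) \<in> borel_measurable borel" if "A \<in> sets borel" for A
    using \<Phi> that by simp
  have int1: "integrable lborel (\<lambda>z. h1 z * indicator A (\<Phi> z))"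
    and int0: "integrable lborel (\<lambda>z. h0 z * indicator A z)" if "A \<in> sets borel" for A
    using that \<Phi>'[OF that]
    by (auto intro!: integrable_mult_bounded(1)[where C = 1] int simp: indicator_def)
  have lim: "(\<lambda>n. \<integral>z. h1 z * indicator (A n) (\<Phi> z) \<partial>lborel) \<longlonglongrightarrow> (\<integral>z. h1 z * indicator B (\<Phi> z) \<partial>lborel)"
    "(\<lambda>n. \<integral>z. h0 z * indicator (A n) z \<partial>lborel) \<longlonglongrightarrow> (\<integral>z. h0 z * indicator B z \<partial>lborel)"
    if "\<And>n::nat. A n \<in> sets borel" "B \<in> sets borel" "\<And>x. (\<lambda>n. indicator (A n) x :: real) \<longlonglongrightarrow> indicator B x" for A B
  proof -
    show "(\<lambda>n. \<integral>z. h1 z * indicator (A n) (\<Phi> z) \<partial>lborel) \<longlonglongrightarrow> (\<integral>z. h1 z * indicator B (\<Phi> z) \<partial>lborel)"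
    proof (rule integral_dominated_convergence[where w = "\<lambda>z. \<bar>h1 z\<bar>"])
      show "AE z in lborel. (\<lambda>n. h1 z * indicator (A n) (\<Phi> z)) \<longlonglongrightarrow> h1 z * indicator B (\<Phi> z)"
        by (intro AE_I2 tendsto_mult tendsto_const that)
      show "AE z in lborel. norm (h1 z * indicator (A n) (\<Phi> z)) \<le> \<bar>h1 z\<bar>" for n
        by (intro AE_I2) (simp add: indicator_def)
    qed (use int(1) \<Phi>'[OF that(1)] \<Phi>'[OF that(2)] in \<open>auto intro!: borel_measurable_times\<close>)
    show "(\<lambda>n. \<integral>z. h0 z * indicator (A n) z \<partial>lborel) \<longlonglongrightarrow> (\<integral>z. h0 z * indicator B z \<partial>lborel)"
    proof (rule integral_dominated_convergence[where w = "\<lambda>z. \<bar>h0 z\<bar>"])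
      show "AE z in lborel. (\<lambda>n. h0 z * indicator (A n) z) \<longlonglongrightarrow> h0 z * indicator B z"
        by (intro AE_I2 tendsto_mult tendsto_const that)
      show "AE z in lborel. norm (h0 z * indicator (A n) z) \<le> \<bar>h0 z\<bar>" for n
        by (intro AE_I2) (simp add: indicator_def)
    qed (use int(2) that in \<open>auto intro!: borel_measurable_times\<close>)
  qed
  \<comment> \<open>The complement step compares total masses; these agree by exhausting the space
    with boxes.\<close>
  have total: "(\<integral>z. h1 z \<partial>lborel) = (\<integral>z. h0 z \<partial>lborel)"
  proof -
    let ?B = "\<lambda>n. box (- (real n *\<^sub>R One)) (real n *\<^sub>R One) :: 'a set"
    have "(\<lambda>n. indicator (?B n) x :: real) \<longlonglongrightarrow> indicator (\<Union>n. ?B n) x" for x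
      by (rule LIMSEQ_indicator_incseq) (auto simp: incseq_def subset_box)
    then have "(\<lambda>n. indicator (?B n) x :: real) \<longlonglongrightarrow> indicator UNIV x" for x
      by (simp add: UN_box_eq_UNIV)
    from lim[OF _ _ this] show ?thesis
      unfolding box by (auto intro: LIMSEQ_unique)
  qed
  have "Int_stable (range (\<lambda>(l, u). box l u :: 'a set))"
    by (auto simp: Int_stable_def box_Int_box)
  moreover have "range (\<lambda>(l, u). box l u :: 'a set) \<subseteq> Pow UNIV" by simp
  moreover have "A \<in> sigma_sets UNIV (range (\<lambda>(l, u). box l u))"
    using A unfolding borel_eq_box by simp
  ultimately show ?thesis
  proof (induction rule: sigma_sets_induct_disjoint)
    case (basic A)
    then show ?case using box by auto
  next
    case empty
    show ?case by simp
  next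
    case (compl A)
    then have A: "A \<in> sets borel" unfolding borel_eq_box by simp
    have "(\<integral>z. h1 z * indicator (UNIV - A) (\<Phi> z) \<partial>lborel) = (\<integral>z. h1 z - h1 z * indicator A (\<Phi> z) \<partial>lborel)"
      by (intro Bochner_Integration.integral_cong) (auto simp: indicator_def)
    moreover have "(\<integral>z. h0 z * indicator (UNIV - A) z \<partial>lborel) = (\<integral>z. h0 z - h0 z * indicator A z \<partial>lborel)"
      by (intro Bochner_Integration.integral_cong) (auto simp: indicator_def)
    ultimately show ?case
      using total compl.IH Bochner_Integration.integral_diff[OF int(1) int1[OF A]]
        Bochner_Integration.integral_diff[OF int(2) int0[OF A]] by simp
  next
    case (union A)
    have A: "A i \<in> sets borel" for i using union.hyps(2) unfolding borel_eq_box by auto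
    have disj: "disjoint_family_on A {..<n}" for n
      using union.hyps(1) by (rule disjoint_family_on_mono[rotated]) simp
    \<comment> \<open>Finite partial unions are handled by sums; dominated convergence then reaches
      the full union.\<close>
    have ind: "indicator (\<Union>i<n. A i) x = (\<Sum>i<n. indicator (A i) x :: real)" for n x
      by (rule indicator_UN_disjoint[OF finite_lessThan disj])
    have eq: "(\<integral>z. h1 z * indicator (\<Union>i<n. A i) (\<Phi> z) \<partial>lborel) = (\<integral>z. h0 z * indicator (\<Union>i<n. A i) z \<partial>lborel)" for n
      unfolding ind sum_distrib_left
      by (simp only: Bochner_Integration.integral_sum[OF int1[OF A]]
          Bochner_Integration.integral_sum[OF int0[OF A]] union.IH)
    have U: "(\<Union>i<n. A i) \<in> sets borel" "(\<Union>i. A i) \<in> sets borel" for n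
      using A by auto
    have "(\<lambda>n. indicator (\<Union>i<n. A i) x :: real) \<longlonglongrightarrow> indicator (\<Union>i. A i) x" for x
      by (rule LIMSEQ_indicator_UN)
    from lim[OF U this] show ?case unfolding eq by (auto intro: LIMSEQ_unique)
  qed
qed

text \<open>Each coordinate contributes two flat factors, steepened by n, one for either face. The
  product vanishes outside the box for every n, so one radius \<open>r\<close> serves the whole
  sequence.\<close>

lemma smooth_box_approximation:
  fixes l u :: "'a::euclidean_space"
  obtains R :: "nat \<Rightarrow> 'a \<Rightarrow> real" and r where "\<And>n k. C_k k (R n)" "\<And>n z. r < norm z \<Longrightarrow> R n z = 0"
    "\<And>n z. \<bar>R n z\<bar> \<le> 1" "\<And>z. (\<lambda>n. R n z) \<longlonglongrightarrow> indicator (box l u) z"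
proof -
  \<comment> \<open>The arguments are spelled out as affine functions of \<open>z\<close> to suit
    the smoothness rules; \<open>b_alt\<close> is the form that shows their signs.\<close>
  define b where "b n j z = flat_exp 0 (- (real n * (l \<bullet> j)) + real n * (z \<bullet> j)) *
    flat_exp 0 (real n * (u \<bullet> j) + (- real n) * (z \<bullet> j))" for n and j z :: 'a
  define R where "R n z = (\<Prod>j\<in>Basis. b n j z)" for n z
  have b_alt: "b n j z = flat_exp 0 (real n * (z \<bullet> j - l \<bullet> j)) * flat_exp 0 (real n * (u \<bullet> j - z \<bullet> j))" for n j z
    by (simp add: b_def algebra_simps)
  have b_bounds: "0 \<le> b n j z" "b n j z \<le> 1" for n j z
    unfolding b_def using flat_exp_bounds by (auto intro: mult_le_one)
  obtain r where r: "\<And>z. z \<in> box l u \<Longrightarrow> norm z \<le> r"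
    using bounded_box[of l u] unfolding bounded_iff by blast
  show thesis
  proof
    show "C_k k (R n)" for n k
      unfolding R_def[abs_def] b_def
      by (intro C_k_prod C_k_mult C_k_compose_real[OF C_k_flat_exp] C_k_add C_k_const C_k_linear
          bounded_linear_inner_left finite_Basis)
    show "R n z = 0" if "r < norm z" for n z
    proof -
      have "z \<notin> box l u" using r[of z] that by force
      then obtain j where j: "j \<in> Basis" "\<not> (l \<bullet> j < z \<bullet> j \<and> z \<bullet> j < u \<bullet> j)"
        unfolding mem_box by blast
      then have "b n j z = 0" by (auto simp: b_alt flat_exp_def zero_less_mult_iff)
      then show ?thesis unfolding R_def using j(1) by (auto intro: prod_zero)
    qed
    show "\<bar>R n z\<bar> \<le> 1" for n z
      unfolding R_def abs_prod using b_bounds by (intro prod_le_1) auto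
    show "(\<lambda>n. R n z) \<longlonglongrightarrow> indicator (box l u) z" for z
    proof -
      have "(\<lambda>n. R n z) \<longlonglongrightarrow> (\<Prod>j\<in>Basis. (if 0 < z \<bullet> j - l \<bullet> j then 1 else 0) * (if 0 < u \<bullet> j - z \<bullet> j then 1 else 0))"
        unfolding R_def b_alt by (intro tendsto_prod tendsto_mult flat_exp_scaled_limit)
      also have "(\<Prod>j\<in>Basis. (if 0 < z \<bullet> j - l \<bullet> j then 1 else 0) * (if 0 < u \<bullet> j - z \<bullet> j then 1 else 0))
          = (indicator (box l u) z :: real)"
      proof (cases "z \<in> box l u")
        case True
        then show ?thesis by (auto simp: mem_box intro!: prod.neutral)
      next
        case False
        then show ?thesis by (auto simp: mem_box intro!: prod_zero)
      qed
      finally show ?thesis .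
    qed
  qed
qed

text \<open>The flow carries the signed density e^(lam t) g(t) to g(0). Tested against the
  transported sign of g(t), this gives the weighted norm of g(t) on one side and at most the norm of
  g(0) on the other.\<close>

lemma exp_decay_L1_norm:
  fixes a :: "real \<Rightarrow> real ^ 'n::finite" and f M :: "real \<Rightarrow> (real ^ 'n) \<times> real \<Rightarrow> real"
  assumes a: "Linf_loc a" and f: "cont_L1 {0..} f" and M: "cont_L1 {0..} M"
    and f_eq: "kinetic_eq a f (\<lambda>t z. lam * (M t z - f t z))"
    and M_eq: "kinetic_eq a M (\<lambda>t z. 0)"
    and t: "0 \<le> t"
  shows "exp (lam * t) * L1_norm (\<lambda>z. f t z - M t z) \<le> L1_norm (\<lambda>z. f 0 z - M 0 z)"
proof -
  define g where "g = (\<lambda>t z. f t z - M t z)"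
  have g: "cont_L1 {0..} g" unfolding g_def by (rule cont_L1_diff[OF f M])
  have int: "integrable lborel (g t)" "integrable lborel (g 0)"
    using g t by (auto simp: cont_L1_def)
  have [measurable]: "g t \<in> borel_measurable borel" using int by auto
  have [measurable]: "a \<in> borel_measurable borel" using a by (simp add: Linf_loc_def)
  define \<Phi> where "\<Phi> s z = (fst z - s *\<^sub>R a (snd z), snd z)" for s and z :: "(real ^ 'n) \<times> real"
  have \<Phi>_meas [measurable]: "\<Phi> s \<in> borel_measurable borel" for s
    unfolding \<Phi>_def borel_prod[symmetric] by measurable
  \<comment> \<open>The shift depends on \<xi> alone, which the flow preserves, so reversing time
    inverts it.\<close>
  have \<Phi>_inv: "\<Phi> (- t) (\<Phi> t z) = z" for z by (simp add: \<Phi>_def)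
  have transport: "(\<integral>z. (exp (lam * t) * g t z) * indicator A (\<Phi> t z) \<partial>lborel) = (\<integral>z. g 0 z * indicator A z \<partial>lborel)"
    if "A \<in> sets borel" for A
  proof (rule borel_pairing_eqI[OF _ int(2) \<Phi>_meas _ that])
    show "integrable lborel (\<lambda>z. exp (lam * t) * g t z)" using int by simp
    fix l u :: "(real ^ 'n) \<times> real"
    obtain R :: "nat \<Rightarrow> (real ^ 'n) \<times> real \<Rightarrow> real" and r
      where R: "\<And>n k. C_k k (R n)" "\<And>n z. r < norm z \<Longrightarrow> R n z = 0"
      and R1: "\<And>n z. \<bar>R n z\<bar> \<le> 1" and lim: "\<And>z. (\<lambda>n. R n z) \<longlonglongrightarrow> indicator (box l u) z"
      by (rule smooth_box_approximation[of l u]) (rule that)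
    have R_meas [measurable]: "R n \<in> borel_measurable borel" for n
      by (rule borel_measurable_continuous_onI[OF C_k_imp_continuous[OF R(1)]])
    have eq: "(\<integral>z. (exp (lam * t) * g t z) * R n (\<Phi> t z) \<partial>lborel) = (\<integral>z. g 0 z * R n z \<partial>lborel)" for n
      using pairing_along_characteristics[where r = r, OF a f M f_eq M_eq R(1) R(2) t, of n]
      by (simp add: g_def \<Phi>_def mult.assoc)
    have "(\<lambda>n. \<integral>z. (exp (lam * t) * g t z) * R n (\<Phi> t z) \<partial>lborel)
        \<longlonglongrightarrow> (\<integral>z. (exp (lam * t) * g t z) * indicator (box l u) (\<Phi> t z) \<partial>lborel)"
    proof (rule integral_dominated_convergence[where w = "\<lambda>z. \<bar>exp (lam * t) * g t z\<bar>"])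
      show "AE z in lborel. (\<lambda>n. exp (lam * t) * g t z * R n (\<Phi> t z))
          \<longlonglongrightarrow> exp (lam * t) * g t z * indicator (box l u) (\<Phi> t z)"
        by (intro AE_I2 tendsto_mult tendsto_const lim)
      show "AE z in lborel. norm (exp (lam * t) * g t z * R n (\<Phi> t z)) \<le> \<bar>exp (lam * t) * g t z\<bar>" for n
        unfolding real_norm_def abs_mult[of "exp (lam * t) * g t _"]
        by (intro AE_I2 mult_left_le R1) simp
      show "integrable lborel (\<lambda>z. \<bar>exp (lam * t) * g t z\<bar>)" using int by simp
    qed measurable
    moreover have "(\<lambda>n. \<integral>z. g 0 z * R n z \<partial>lborel) \<longlonglongrightarrow> (\<integral>z. g 0 z * indicator (box l u) z \<partial>lborel)"
    proof (rule integral_dominated_convergence[where w = "\<lambda>z. \<bar>g 0 z\<bar>"])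
      show "AE z in lborel. (\<lambda>n. g 0 z * R n z) \<longlonglongrightarrow> g 0 z * indicator (box l u) z"
        by (intro AE_I2 tendsto_mult tendsto_const lim)
      show "AE z in lborel. norm (g 0 z * R n z) \<le> \<bar>g 0 z\<bar>" for n
        unfolding real_norm_def abs_mult by (intro AE_I2 mult_left_le R1) simp
    qed (use int(2) R_meas in \<open>auto intro!: borel_measurable_times\<close>)
    ultimately show "(\<integral>z. (exp (lam * t) * g t z) * indicator (box l u) (\<Phi> t z) \<partial>lborel)
        = (\<integral>z. g 0 z * indicator (box l u) z \<partial>lborel)"
      unfolding eq by (rule LIMSEQ_unique)
  qed
  \<comment> \<open>The images under \<open>\<Phi> t\<close> of the sets where \<open>g t\<close> is
    positive and negative; written as preimages under the inverse flow, they are Borel.\<close>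
  define A B where "A = {z. 0 < g t (\<Phi> (- t) z)}" and "B = {z. g t (\<Phi> (- t) z) < 0}"
  have AB: "A \<in> sets borel" "B \<in> sets borel"
  proof -
    have "{z \<in> space borel. 0 < g t (\<Phi> (- t) z)} \<in> sets borel"
      "{z \<in> space borel. g t (\<Phi> (- t) z) < 0} \<in> sets borel" by measurable
    then show "A \<in> sets borel" "B \<in> sets borel" by (simp_all add: A_def B_def)
  qed
  have ind: "indicator A (\<Phi> t z) - indicator B (\<Phi> t z) = sgn (g t z)" for z
    by (auto simp: A_def B_def \<Phi>_inv indicator_def sgn_if)
  have int_ind: "integrable lborel (\<lambda>z. (exp (lam * t) * g t z) * indicator C (\<Phi> t z))"
    "integrable lborel (\<lambda>z. g 0 z * indicator C z)" if [measurable]: "C \<in> sets borel" for C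
  proof -
    have "(\<lambda>z. indicator C (\<Phi> t z) :: real) \<in> borel_measurable borel"
      "(\<lambda>z. indicator C z :: real) \<in> borel_measurable borel" by measurable
    then show "integrable lborel (\<lambda>z. (exp (lam * t) * g t z) * indicator C (\<Phi> t z))"
      "integrable lborel (\<lambda>z. g 0 z * indicator C z)"
      using int
      by (auto intro!: integrable_mult_bounded(1)[where g = "\<lambda>z. exp (lam * t) * g t z" and C = 1]
          integrable_mult_bounded(1)[where g = "g 0" and C = 1] simp: indicator_def)
  qed
  have "exp (lam * t) * L1_norm (g t) = (\<integral>z. (exp (lam * t) * g t z) * indicator A (\<Phi> t z)
      - (exp (lam * t) * g t z) * indicator B (\<Phi> t z) \<partial>lborel)"
    unfolding L1_norm_def integral_mult_right_zero[symmetric] right_diff_distrib[symmetric] ind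
    by (simp add: mult.assoc abs_sgn)
  also have "\<dots> = (\<integral>z. g 0 z * indicator A z - g 0 z * indicator B z \<partial>lborel)"
    by (simp only: Bochner_Integration.integral_diff int_ind AB transport)
  \<comment> \<open>\<open>A\<close> and \<open>B\<close> are disjoint, so the difference of their
    indicators lies between -1 and 1.\<close>
  also have "\<dots> \<le> L1_norm (g 0)"
    unfolding L1_norm_def
    by (intro integral_mono Bochner_Integration.integrable_diff integrable_abs int_ind AB int(2))
      (auto simp: A_def B_def indicator_def)
  finally show ?thesis by (simp add: g_def)
qed

lemma chi_integral: "(LINT \<xi>|lborel. chi \<xi> u) = u"
proof (cases "0 \<le> u")
  case True
  have "(LINT \<xi>|lborel. chi \<xi> u) = (LINT \<xi>|lborel. indicator {0<..<u} \<xi>)"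
    using True by (intro Bochner_Integration.integral_cong) (auto simp: chi_def indicator_def)
  then show ?thesis using True by simp
next
  case False
  have "(LINT \<xi>|lborel. chi \<xi> u) = (LINT \<xi>|lborel. - indicator {u<..<0} \<xi>)"
    using False by (intro Bochner_Integration.integral_cong) (auto simp: chi_def indicator_def)
  then show ?thesis using False by simp
qed

subsection \<open>Marginals and exponential decay\<close>

lemma L1_norm_marginal:
  fixes g :: "'a::euclidean_space \<times> real \<Rightarrow> real"
  assumes g: "integrable lborel g"
  shows "integrable lborel (\<lambda>x. LINT \<xi>|lborel. g (x, \<xi>))"
    and "L1_norm (\<lambda>x. LINT \<xi>|lborel. g (x, \<xi>)) \<le> L1_norm g"
proof -
  have g': "integrable (lborel \<Otimes>\<^sub>M lborel) g" by (simp add: lborel_prod g)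
  show int: "integrable lborel (\<lambda>x. LINT \<xi>|lborel. g (x, \<xi>))"
    by (rule lborel_pair.integrable_fst'[OF g'])
  have abs': "integrable (lborel \<Otimes>\<^sub>M lborel) (\<lambda>z. \<bar>g z\<bar>)" using g' by simp
  have "L1_norm (\<lambda>x. LINT \<xi>|lborel. g (x, \<xi>)) \<le> (LINT x|lborel. LINT \<xi>|lborel. \<bar>g (x, \<xi>)\<bar>)"
    unfolding L1_norm_def
    by (intro integral_mono integrable_abs int lborel_pair.integrable_fst'[OF abs'] integral_abs_bound)
  also have "\<dots> = L1_norm g"
    using lborel_pair.integral_fst'[OF abs'] by (simp add: L1_norm_def lborel_prod)
  finally show "L1_norm (\<lambda>x. LINT \<xi>|lborel. g (x, \<xi>)) \<le> L1_norm g" .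
qed

lemma L1_norm_marginal_diff:
  fixes f h :: "'a::euclidean_space \<times> real \<Rightarrow> real"
  assumes f: "integrable lborel f" and h: "integrable lborel h"
  defines "d \<equiv> \<lambda>x. (LINT \<xi>|lborel. f (x, \<xi>)) - (LINT \<xi>|lborel. h (x, \<xi>))"
  shows "integrable lborel d" and "L1_norm d \<le> L1_norm (\<lambda>z. f z - h z)"
proof -
  have fh: "integrable lborel (\<lambda>z. f z - h z)" using f h by simp
  show int: "integrable lborel d"
    unfolding d_def by (intro Bochner_Integration.integrable_diff L1_norm_marginal(1) f h)
  have "integrable (lborel \<Otimes>\<^sub>M lborel) f" "integrable (lborel \<Otimes>\<^sub>M lborel) h"
    using f h by (simp_all add: lborel_prod)
  \<comment> \<open>Sections are integrable only for almost every x; elsewhere the default value 0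
    may keep the integral of the difference from splitting.\<close>
  from this[THEN lborel_pair.AE_integrable_fst']
  have "AE x in lborel. d x = (LINT \<xi>|lborel. f (x, \<xi>) - h (x, \<xi>))"
    by eventually_elim (simp add: d_def)
  then have "L1_norm d = L1_norm (\<lambda>x. LINT \<xi>|lborel. f (x, \<xi>) - h (x, \<xi>))"
    unfolding L1_norm_def using int L1_norm_marginal(1)[OF fh]
    by (intro integral_cong_AE) auto
  also have "\<dots> \<le> L1_norm (\<lambda>z. f z - h z)" by (rule L1_norm_marginal(2)[OF fh])
  finally show "L1_norm d \<le> L1_norm (\<lambda>z. f z - h z)" .
qed

lemma exp_decay_limit:
  fixes N :: "real \<Rightarrow> real"
  assumes "lam > 0" and N: "\<And>t. 0 \<le> t \<Longrightarrow> 0 \<le> N t" "\<And>t. 0 \<le> t \<Longrightarrow> exp (lam * t) * N t \<le> C"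
  shows "(N \<longlongrightarrow> 0) at_top" and "N \<in> O[at_top](\<lambda>t. exp (- lam * t))"
proof -
  have bound: "\<forall>\<^sub>F t in at_top. norm (N t) \<le> C * norm (exp (- lam * t))"
    using eventually_ge_at_top[of 0]
    by eventually_elim (use N in \<open>simp add: exp_minus field_simps\<close>)
  then show O: "N \<in> O[at_top](\<lambda>t. exp (- lam * t))" by (rule bigoI)
  have "filterlim (\<lambda>t. - lam * t) at_bot at_top"
    using assms(1) by (intro filterlim_tendsto_neg_mult_at_bot[OF tendsto_const] filterlim_ident) auto
  then have "((\<lambda>t. exp (- lam * t)) \<longlongrightarrow> 0) at_top" by (rule filterlim_compose[OF exp_at_bot])
  then have "((\<lambda>t. C * norm (exp (- lam * t))) \<longlongrightarrow> C * norm (0::real)) at_top"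
    by (intro tendsto_intros)
  then show "(N \<longlongrightarrow> 0) at_top"
    by (intro Lim_null_comparison[OF bound]) simp
qed

theorem proposition2p3:
  fixes lam :: real
    and a :: "real \<Rightarrow> real ^ 'n::finite"
    and u0 :: "real ^ 'n \<Rightarrow> real"
    and u uhat :: "real \<Rightarrow> real ^ 'n \<Rightarrow> real"
    and f0 :: "(real ^ 'n) \<times> real \<Rightarrow> real"
    and M f :: "real \<Rightarrow> (real ^ 'n) \<times> real \<Rightarrow> real"
  assumes lam_pos: "lam > 0"
    and a: "Linf_loc a"
    and u0: "integrable lborel u0"
    and M_def: "\<And>t x \<xi>. M t (x, \<xi>) = chi \<xi> (u t x)"
    and M_cont: "\<And>T. T > 0 \<Longrightarrow> cont_L1 {0..T} M"
    and M_eq: "kinetic_eq a M (\<lambda>t z. 0)"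
    and M_init: "AE (x, \<xi>) in lborel. M 0 (x, \<xi>) = chi \<xi> (u0 x)"
    and f0: "integrable lborel f0"
    and f_cont: "cont_L1 {0..} f"
    and f_eq: "kinetic_eq a f (\<lambda>t z. lam * (M t z - f t z))"
    and f_init: "AE z in lborel. f 0 z = f0 z"
    and uhat_def: "\<And>t x. uhat t x = (LINT \<xi>|lborel. f t (x, \<xi>))"
  shows "((\<lambda>t. L1_norm (\<lambda>z. f t z - M t z)) \<longlongrightarrow> 0) at_top
    \<and> (\<lambda>t. L1_norm (\<lambda>z. f t z - M t z)) \<in> O[at_top](\<lambda>t. exp (- lam * t))
    \<and> (\<forall>t\<ge>0. integrable lborel (\<lambda>x. uhat t x - u t x))
    \<and> ((\<lambda>t. L1_norm (\<lambda>x. uhat t x - u t x)) \<longlongrightarrow> 0) at_top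
    \<and> (\<lambda>t. L1_norm (\<lambda>x. uhat t x - u t x)) \<in> O[at_top](\<lambda>t. exp (- lam * t))"
proof -
  have M: "cont_L1 {0..} M" by (rule cont_L1_atLeast[OF M_cont])
  have decay: "exp (lam * t) * L1_norm (\<lambda>z. f t z - M t z) \<le> L1_norm (\<lambda>z. f 0 z - M 0 z)"
    if "0 \<le> t" for t
    by (rule exp_decay_L1_norm[OF a f_cont M f_eq M_eq that])
  have pos: "0 \<le> L1_norm h" for h :: "'b::euclidean_space \<Rightarrow> real" by (simp add: L1_norm_def)
  \<comment> \<open>\<open>u\<close> is the \<xi>-marginal of \<open>M\<close>, so
    \<open>uhat t x - u t x\<close> is a difference of marginals and inherits the decay of f -
    M.\<close>
  have u_eq: "u t x = (LINT \<xi>|lborel. M t (x, \<xi>))" for t x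
    by (simp add: M_def chi_integral)
  have marginal: "integrable lborel (\<lambda>x. uhat t x - u t x)"
    "L1_norm (\<lambda>x. uhat t x - u t x) \<le> L1_norm (\<lambda>z. f t z - M t z)" if "0 \<le> t" for t
  proof -
    have "integrable lborel (f t)" "integrable lborel (M t)"
      using f_cont M that by (auto simp: cont_L1_def)
    then show "integrable lborel (\<lambda>x. uhat t x - u t x)"
      "L1_norm (\<lambda>x. uhat t x - u t x) \<le> L1_norm (\<lambda>z. f t z - M t z)"
      unfolding uhat_def u_eq by (rule L1_norm_marginal_diff)+
  qed
  have "exp (lam * t) * L1_norm (\<lambda>x. uhat t x - u t x) \<le> L1_norm (\<lambda>z. f 0 z - M 0 z)"
    if "0 \<le> t" for t
    by (rule order_trans[OF mult_left_mono[OF marginal(2)[OF that]] decay[OF that]]) simp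
  note decay_u = this
  show ?thesis
    using exp_decay_limit[OF lam_pos pos decay] exp_decay_limit[OF lam_pos pos decay_u] marginal(1)
    by blast
qed

end
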